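(* Let $q=q(\alpha)$ be the density function of a random variable $\alpha$ taking values in $(0,1)$ almost surely, let $k_\alpha=\alpha/(1-\alpha)$, and assume $\int_0^1 k_\alpha q(\alpha)\,d\alpha<\infty$. Let ${}^{CF}D_x^{q(\alpha)}$ be the convolution operator $${}^{CF}D_x^{q(\alpha)}f(x)=\int_0^x\frac{d}{dz}f(z)\left(\int_0^1 e^{-\frac{\alpha}{1-\alpha}(x-z)}q(\alpha)\,d\alpha\right)dz .$$ Let moreover $A_q(x):=\int_0^1 k_\alpha e^{-k_\alpha x}q(\alpha)\,d\alpha$ and $B_q(x):=\left[\int_0^1 k_\alpha q(\alpha)\,d\alpha\right]\left[\int_0^1 e^{-k_\alpha x}q(\alpha)\,d\alpha\right]$, for $x\ge0$. Then the solution to the equation $$\frac{\partial}{\partial t}f(x,t)=-\,{}^{CF}D_x^{q(\alpha)}f(x,t)+e^{-t}A_q(x)-te^{-t}B_q(x),\qquad x\ge0,\ t\ge0,$$ with initial condition $f(x,0)=0$, is given by the density of the absolutely continuous component of the compound Poisson process $\mathcal S_\psi(t)=\sum_{j=1}^{N(t)}X_j^\psi$, where the $X_j^\psi$, $j=1,2,\dots$, are independent and identically distributed random variables with density $f_{X_j^\psi}(x)=A_q(x)$, $x\ge0$.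
   Context: The operator ${}^{CF}D_x^{q(\alpha)}$ is defined for $x>0$, for differentiable functions $f$ in $AC_{loc}(0,+\infty)$; applied to $f(x,t)$ it acts on the variable $x$. Compound Poisson process: in $\mathcal S_\psi(t)=\sum_{j=1}^{N(t)}X_j^\psi$, $t\ge0$, $N(t)$ is a Poisson process with parameter $1$ and the $X_j^\psi$ are non-negative i.i.d. random variables independent of $N$. Its distribution function is $P\{\mathcal S_\psi(t)<y\}=e^{-t}1_{[0,+\infty)}(y)+\int_{-\infty}^y f_{\mathcal S_\psi}(x,t)\,dx$, and $f_{\mathcal S_\psi}(\cdot,t)$ is called the density of the absolutely continuous component of $\mathcal S_\psi$; it equals $e^{-t}\sum_{n\ge1}\frac{t^n}{n!}f_{X^\psi}^{*(n)}(x)$, with $f^{*(n)}$ the $n$-fold convolution. *)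

theory Defs
  imports "HOL-Probability.Probability"
begin

section \<open>The distributed-order Caputo--Fabrizio operator\<close>

definition k_rate :: "real \<Rightarrow> real" where
  "k_rate a = a / (1 - a)"

definition CF_kernel :: "(real \<Rightarrow> real) \<Rightarrow> real \<Rightarrow> real" where
  "CF_kernel q x = (LBINT a:{0<..<1}. exp (- k_rate a * x) * q a)"

definition CF_deriv :: "(real \<Rightarrow> real) \<Rightarrow> (real \<Rightarrow> real) \<Rightarrow> real \<Rightarrow> real" where
  "CF_deriv q f x = (LBINT z:{0<..<x}. deriv f z * CF_kernel q (x - z))"

definition abs_continuous_on_Icc :: "real \<Rightarrow> real \<Rightarrow> (real \<Rightarrow> real) \<Rightarrow> bool" where
  "abs_continuous_on_Icc a b f \<longleftrightarrow>
     (\<forall>\<epsilon>>0. \<exists>\<delta>>0. \<forall>(n::nat) l u.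
        (\<forall>i<n. a \<le> l i \<and> l i \<le> u i \<and> u i \<le> b) \<and>
        disjoint_family_on (\<lambda>i. {l i<..<u i}) {..<n} \<and>
        (\<Sum>i<n. u i - l i) < \<delta> \<longrightarrow>
        (\<Sum>i<n. \<bar>f (u i) - f (l i)\<bar>) < \<epsilon>)"

definition AC_loc_pos :: "(real \<Rightarrow> real) \<Rightarrow> bool" where
  "AC_loc_pos f \<longleftrightarrow> (\<forall>a b. 0 < a \<and> a \<le> b \<longrightarrow> abs_continuous_on_Icc a b f)"

text \<open>
  Membership of \<open>AC_loc_pos\<close> does not control \<open>f\<close> near \<open>0\<close>, and the Bochner integral of a
  non-integrable function is \<open>0\<close>; so the domain of the operator also has to ask that the
  defining integral exists.
\<close>

definition CF_domain :: "(real \<Rightarrow> real) \<Rightarrow> (real \<Rightarrow> real) \<Rightarrow> bool" where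
  "CF_domain q f \<longleftrightarrow>
     (\<forall>x>0. f differentiable (at x)) \<and> AC_loc_pos f \<and>
     (\<forall>x>0. set_integrable lborel {0<..<x} (\<lambda>z. deriv f z * CF_kernel q (x - z)))"

definition A_q :: "(real \<Rightarrow> real) \<Rightarrow> real \<Rightarrow> real" where
  "A_q q x = (LBINT a:{0<..<1}. k_rate a * exp (- k_rate a * x) * q a)"

definition B_q :: "(real \<Rightarrow> real) \<Rightarrow> real \<Rightarrow> real" where
  "B_q q x = (LBINT a:{0<..<1}. k_rate a * q a) * (LBINT a:{0<..<1}. exp (- k_rate a * x) * q a)"

text \<open>
  Only the values \<open>f x t\<close> with \<open>x, t \<ge> 0\<close> matter; the time derivative at \<open>t = 0\<close> is one-sided.
\<close>

definition CF_solution :: "(real \<Rightarrow> real) \<Rightarrow> (real \<Rightarrow> real \<Rightarrow> real) \<Rightarrow> bool" where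
  "CF_solution q f \<longleftrightarrow>
     (\<forall>t\<ge>0. CF_domain q (\<lambda>x. f x t)) \<and>
     (\<forall>x\<ge>0. \<forall>t\<ge>0.
        ((\<lambda>s. f x s) has_real_derivative
           - CF_deriv q (\<lambda>y. f y t) x + exp (- t) * A_q q x - t * exp (- t) * B_q q x)
          (at t within {0..})) \<and>
     (\<forall>x\<ge>0. f x 0 = 0)"

section \<open>Compound Poisson processes\<close>

text \<open>
  Paths of a Poisson process are almost surely nondecreasing, so the truncated
  differences of natural numbers are almost surely the true increments.
\<close>

definition (in prob_space) poisson_process :: "real \<Rightarrow> (real \<Rightarrow> 'a \<Rightarrow> nat) \<Rightarrow> bool" where
  "poisson_process rate N \<longleftrightarrow>
     (\<forall>t\<ge>0. random_variable (count_space UNIV) (N t)) \<and>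
     (AE \<omega> in M. N 0 \<omega> = 0 \<and> mono_on {0..} (\<lambda>t. N t \<omega>) \<and>
        (\<forall>t\<ge>0. continuous (at_right t) (\<lambda>s. N s \<omega>))) \<and>
     (\<forall>n (\<tau>::nat \<Rightarrow> real). 0 \<le> \<tau> 0 \<and> mono \<tau> \<longrightarrow>
        indep_vars (\<lambda>_. count_space UNIV) (\<lambda>i \<omega>. N (\<tau> (Suc i)) \<omega> - N (\<tau> i) \<omega>) {..<n}) \<and>
     (\<forall>s t. 0 \<le> s \<and> s < t \<longrightarrow>
        distr M (count_space UNIV) (\<lambda>\<omega>. N t \<omega> - N s \<omega>)
          = measure_pmf (poisson_pmf (rate * (t - s))))"

definition (in prob_space) indep_process_sequence ::
    "(real \<Rightarrow> 'a \<Rightarrow> nat) \<Rightarrow> (nat \<Rightarrow> 'a \<Rightarrow> real) \<Rightarrow> bool" where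
  "indep_process_sequence N X \<longleftrightarrow>
     indep_set
       (sets (vimage_algebra (space M) (\<lambda>\<omega>. \<lambda>t\<in>{0..}. N t \<omega>)
                (PiM {0..} (\<lambda>_. count_space UNIV))))
       (sets (vimage_algebra (space M) (\<lambda>\<omega>. \<lambda>j\<in>{1..}. X j \<omega>)
                (PiM {1..} (\<lambda>_. borel))))"

definition compound_sum ::
    "(real \<Rightarrow> 'a \<Rightarrow> nat) \<Rightarrow> (nat \<Rightarrow> 'a \<Rightarrow> real) \<Rightarrow> real \<Rightarrow> 'a \<Rightarrow> real" where
  "compound_sum N X t \<omega> = (\<Sum>j = 1..N t \<omega>. X j \<omega>)"

text \<open>
  \<open>g\<close> is the density of the absolutely continuous component of the law of \<open>Y\<close>,
  whose remaining part is an atom of mass \<open>p\<close> at \<open>0\<close>.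
\<close>

definition (in prob_space) ac_component_density ::
    "real \<Rightarrow> ('a \<Rightarrow> real) \<Rightarrow> (real \<Rightarrow> real) \<Rightarrow> bool" where
  "ac_component_density p Y g \<longleftrightarrow>
     random_variable borel Y \<and> integrable lborel g \<and> (\<forall>x. 0 \<le> g x) \<and>
     (\<forall>y. cdf (distr M borel Y) y = p * indicator {0..} y + (LBINT x:{..y}. g x))"

definition conv :: "(real \<Rightarrow> real) \<Rightarrow> (real \<Rightarrow> real) \<Rightarrow> real \<Rightarrow> real" where
  "conv f g x = (\<integral>y. f (x - y) * g y \<partial>lborel)"

text \<open>The \<open>n\<close>-fold convolution, for \<open>n \<ge> 1\<close>.\<close>

definition conv_power :: "(real \<Rightarrow> real) \<Rightarrow> nat \<Rightarrow> real \<Rightarrow> real" where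
  "conv_power f n = (conv f ^^ (n - 1)) f"

text \<open>
  Densities are determined only almost everywhere, whereas the equation is to hold at every
  point; the convolution series fixes the version. The series starts at \<open>n = 1\<close>.
\<close>

definition compound_poisson_density :: "(real \<Rightarrow> real) \<Rightarrow> real \<Rightarrow> real \<Rightarrow> real" where
  "compound_poisson_density f x t =
     exp (- t) * (\<Sum>n. t ^ Suc n / fact (Suc n) * conv_power f (Suc n) x)"

definition jump_density :: "(real \<Rightarrow> real) \<Rightarrow> real \<Rightarrow> real" where
  "jump_density q x = (if 0 \<le> x then A_q q x else 0)"

end

theory Submission
  imports Defs
begin

text \<open>
  Write \<open>a\<close> for the jump density, \<open>K = a(0)\<close> and \<open>\<phi>\<close> for the kernel of the operator, so that \<open>\<phi>' = - a\<close> and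
  \<open>\<phi>(0) = 1\<close>. Integrating by parts, the operator maps \<open>f\<close> to \<open>f - f(0+) \<phi> - a * f\<close>. For the compound
  Poisson density \<open>f(0+, t) = t e\<^sup>-\<^sup>t K\<close>, and the boundary term cancels the inhomogeneity \<open>t e\<^sup>-\<^sup>t B\<close>; what remains
  is the Kolmogorov equation \<open>\<partial>\<^sub>t f = - f + a * f + e\<^sup>-\<^sup>t a\<close>, which the convolution series satisfies termwise.

  For uniqueness, the difference \<open>h\<close> of two solutions satisfies \<open>\<partial>\<^sub>t h = - D\<close>, where \<open>\<bar>D(x, t)\<bar>\<close> is at most
  twice the oscillation of \<open>h(\<cdot>, t)\<close> on \<open>(0, x]\<close>. A Gronwall argument for the oscillation gives \<open>h = 0\<close> once
  the oscillation is known to be bounded locally uniformly in time. A solution need not be continuous in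
  both variables, and \<open>f(0, t)\<close> need not be \<open>f(0+, t)\<close>; the local bound comes from Baire's theorem.
\<close>

section \<open>Parameter integrals\<close>

text \<open>The mean value inequality on the convex set \<open>S\<close> bounds the difference
  quotients by \<open>b\<close>, so dominated convergence applies along sequences. Working within
  \<open>S\<close> gives one-sided derivatives at the end of a half-line.\<close>

lemma has_real_derivative_lebesgue_integral:
  fixes g g' :: "'a \<Rightarrow> real \<Rightarrow> real"
  assumes S: "convex S" "x \<in> S"
    and int: "\<And>y. y \<in> S \<Longrightarrow> integrable M (\<lambda>w. g w y)"
    and meas: "(\<lambda>w. g' w x) \<in> borel_measurable M"
    and der: "\<And>w y. w \<in> space M \<Longrightarrow> y \<in> S \<Longrightarrow> (g w has_real_derivative g' w y) (at y within S)"
    and bnd: "\<And>w y. w \<in> space M \<Longrightarrow> y \<in> S \<Longrightarrow> \<bar>g' w y\<bar> \<le> b w"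
    and b: "integrable M b"
  shows "((\<lambda>y. \<integral>w. g w y \<partial>M) has_real_derivative (\<integral>w. g' w x \<partial>M)) (at x within S)"
  unfolding has_field_derivative_iff tendsto_at_iff_sequentially o_def
proof (intro allI impI)
  fix Y :: "nat \<Rightarrow> real" assume Y: "\<forall>i. Y i \<in> S - {x}" "Y \<longlonglongrightarrow> x"
  have Ym: "Y i \<in> S" "Y i \<noteq> x" for i using Y by auto
  have "(\<lambda>n. \<integral>w. (g w (Y n) - g w x) / (Y n - x) \<partial>M) \<longlonglongrightarrow> (\<integral>w. g' w x \<partial>M)"
  proof (rule integral_dominated_convergence[where w = b])
    show "(\<lambda>w. (g w (Y n) - g w x) / (Y n - x)) \<in> borel_measurable M" for n
      using int[OF Ym(1)[of n]] int[OF S(2)] by (intro borel_measurable_divide) auto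
    show "AE w in M. (\<lambda>n. (g w (Y n) - g w x) / (Y n - x)) \<longlonglongrightarrow> g' w x"
    proof (rule AE_I2)
      fix w assume "w \<in> space M"
      from der[OF this S(2)] show "(\<lambda>n. (g w (Y n) - g w x) / (Y n - x)) \<longlonglongrightarrow> g' w x"
        unfolding has_field_derivative_iff tendsto_at_iff_sequentially o_def using Y by blast
    qed
    show "AE w in M. norm ((g w (Y n) - g w x) / (Y n - x)) \<le> b w" for n
    proof (rule AE_I2)
      fix w assume w: "w \<in> space M"
      have "norm (g w (Y n) - g w x) \<le> b w * norm (Y n - x)"
        by (rule field_differentiable_bound[OF S(1) der[OF w]]) (use bnd[OF w] Ym S in auto)
      then show "norm ((g w (Y n) - g w x) / (Y n - x)) \<le> b w"
        using Ym(2)[of n] by (simp add: field_simps)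
    qed
  qed (use b meas in auto)
  moreover have "(\<integral>w. (g w (Y n) - g w x) / (Y n - x) \<partial>M)
      = ((\<integral>w. g w (Y n) \<partial>M) - (\<integral>w. g w x \<partial>M)) / (Y n - x)" for n
    using int[OF Ym(1)[of n]] int[OF S(2)] by simp
  ultimately show "(\<lambda>n. ((\<integral>w. g w (Y n) \<partial>M) - (\<integral>w. g w x \<partial>M)) / (Y n - x)) \<longlonglongrightarrow> (\<integral>w. g' w x \<partial>M)"
    by (simp only:)
qed

lemma continuous_on_lebesgue_integral:
  fixes g :: "'a \<Rightarrow> real \<Rightarrow> real"
  assumes meas: "\<And>y. y \<in> S \<Longrightarrow> (\<lambda>w. g w y) \<in> borel_measurable M"
    and cont: "\<And>w. w \<in> space M \<Longrightarrow> continuous_on S (g w)"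
    and bnd: "\<And>w y. w \<in> space M \<Longrightarrow> y \<in> S \<Longrightarrow> \<bar>g w y\<bar> \<le> b w"
    and b: "integrable M b"
  shows "continuous_on S (\<lambda>y. \<integral>w. g w y \<partial>M)"
proof (rule continuous_on_sequentiallyI)
  fix u a assume u: "\<forall>n::nat. u n \<in> S" "a \<in> S" "u \<longlonglongrightarrow> a"
  show "(\<lambda>n. \<integral>w. g w (u n) \<partial>M) \<longlonglongrightarrow> (\<integral>w. g w a \<partial>M)"
  proof (rule integral_dominated_convergence[where w = b])
    show "AE w in M. (\<lambda>n. g w (u n)) \<longlonglongrightarrow> g w a"
      using cont u by (intro AE_I2) (auto simp: continuous_on_sequentially o_def)
  qed (use u meas b bnd in auto)
qed

text \<open>In the application \<^term>\<open>\<mu>\<close> is the law of \<open>\<alpha>\<close>, with density \<open>q\<close> on \<open>(0, 1)\<close>, and \<^term>\<open>k\<close> is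
  \<^const>\<open>k_rate\<close>.\<close>

locale rate_mixture = prob_space \<mu> for \<mu> :: "'r measure" +
  fixes k :: "'r \<Rightarrow> real"
  assumes k_nonneg: "\<And>r. r \<in> space \<mu> \<Longrightarrow> 0 \<le> k r"
    and k_integrable: "integrable \<mu> k"
begin

section \<open>The kernel, the jump density and their derivatives\<close>

definition phi :: "real \<Rightarrow> real" where "phi x = (\<integral>r. exp (- k r * x) \<partial>\<mu>)"
definition A :: "real \<Rightarrow> real" where "A x = (\<integral>r. k r * exp (- k r * x) \<partial>\<mu>)"
text \<open>The derivative of \<open>A\<close> at positive arguments only. If \<open>k\<close> has
  infinite second moment, \<open>A'\<close> is unbounded near 0, while the Bochner integral gives
  the default \<open>A' 0 = 0\<close>.\<close>

definition A' :: "real \<Rightarrow> real" where "A' x = - (\<integral>r. (k r)\<^sup>2 * exp (- k r * x) \<partial>\<mu>)"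
definition J :: "real \<Rightarrow> real" where "J x = (if 0 \<le> x then A x else 0)"
definition K :: real where "K = (\<integral>r. k r \<partial>\<mu>)"

lemma k_measurable [measurable]: "k \<in> borel_measurable \<mu>"
  using k_integrable by auto

lemma exp_rate_le_1: "r \<in> space \<mu> \<Longrightarrow> 0 \<le> x \<Longrightarrow> exp (- k r * x) \<le> 1"
  using k_nonneg by simp

lemma integrable_phi: "0 \<le> x \<Longrightarrow> integrable \<mu> (\<lambda>r. exp (- k r * x))"
  by (rule integrable_const_bound[where B = 1]) (use exp_rate_le_1 in auto)

lemma integrable_A: "0 \<le> x \<Longrightarrow> integrable \<mu> (\<lambda>r. k r * exp (- k r * x))"
  by (rule Bochner_Integration.integrable_bound[OF k_integrable])
     (auto simp: k_nonneg abs_mult intro!: mult_left_le)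

lemma A_nonneg: "0 \<le> A x"
  unfolding A_def by (rule integral_nonneg_AE) (auto simp: k_nonneg)

lemma K_nonneg: "0 \<le> K"
  unfolding K_def by (rule integral_nonneg_AE) (auto simp: k_nonneg)

lemma A_0: "A 0 = K" by (simp add: A_def K_def)

lemma A_le_K: "0 \<le> x \<Longrightarrow> A x \<le> K"
  unfolding A_def K_def
  by (rule integral_mono[OF integrable_A k_integrable]) (auto simp: k_nonneg intro!: mult_left_le)

lemma phi_0: "phi 0 = 1" by (simp add: phi_def prob_space)

lemma phi_le_1: "0 \<le> x \<Longrightarrow> phi x \<le> 1"
  using integral_mono[OF integrable_phi, of x "\<lambda>_. 1"] exp_rate_le_1
  by (simp add: phi_def prob_space)

lemma phi_antimono: "0 \<le> x \<Longrightarrow> x \<le> y \<Longrightarrow> phi y \<le> phi x"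
  unfolding phi_def
  by (rule integral_mono[OF integrable_phi integrable_phi]) (auto simp: k_nonneg mult_left_mono)

text \<open>A mean of strictly positive exponentials cannot vanish. Positivity later allows division
  by the kernel.\<close>

lemma phi_pos: "0 \<le> x \<Longrightarrow> 0 < phi x"
proof -
  assume x: "0 \<le> x"
  have "phi x \<noteq> 0"
  proof
    assume "phi x = 0"
    then have "AE r in \<mu>. exp (- k r * x) = 0"
      unfolding phi_def by (subst integral_nonneg_eq_0_iff_AE[symmetric]) (use integrable_phi[OF x] in auto)
    then have "AE r in \<mu>. False" by simp
    then show False using AE_False by simp
  qed
  moreover have "0 \<le> phi x" unfolding phi_def by (rule integral_nonneg_AE) auto
  ultimately show ?thesis by simp
qed

lemma phi_has_derivative:
  assumes "0 \<le> x" shows "(phi has_real_derivative - A x) (at x within {0..})"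
proof -
  have "(phi has_real_derivative (\<integral>r. - (k r * exp (- k r * x)) \<partial>\<mu>)) (at x within {0..})"
    unfolding phi_def
    by (rule has_real_derivative_lebesgue_integral[where b = k])
       (use assms integrable_phi in \<open>auto simp: k_nonneg k_integrable abs_mult
          intro!: derivative_eq_intros mult_left_le\<close>)
  then show ?thesis by (simp add: A_def)
qed

lemma A_continuous: "continuous_on {0..} A"
  unfolding A_def
  by (rule continuous_on_lebesgue_integral[where b = k])
     (auto simp: k_nonneg k_integrable abs_mult intro!: mult_left_le continuous_intros)

text \<open>The inequality \<open>u * exp (- u) \<le> 1\<close> for \<open>u = k r * c\<close>
  trades one factor \<open>k r\<close> for \<open>1 / c\<close>. So \<open>k r / c\<close> is an
  integrable dominating function on \<open>{c..}\<close> even if \<open>k\<close> has infinite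
  second moment.\<close>

lemma square_rate_bound:
  assumes r: "r \<in> space \<mu>" and c: "0 < c" "c \<le> x"
  shows "(k r)\<^sup>2 * exp (- k r * x) \<le> k r / c"
proof -
  have "k r * c * exp (- (k r * c)) \<le> 1"
    using order_trans[OF _ exp_ge_add_one_self[of "k r * c"], of "k r * c"]
    by (simp add: exp_minus field_simps)
  then have "k r * exp (- k r * c) \<le> 1 / c"
    using c by (simp add: field_simps)
  then have "k r * (k r * exp (- k r * c)) \<le> k r * (1 / c)"
    using k_nonneg[OF r] by (intro mult_left_mono)
  moreover have "exp (- k r * x) \<le> exp (- k r * c)"
    using k_nonneg[OF r] c by (simp add: mult_left_mono)
  then have "(k r)\<^sup>2 * exp (- k r * x) \<le> (k r)\<^sup>2 * exp (- k r * c)"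
    by (intro mult_left_mono) auto
  ultimately show ?thesis by (simp add: power2_eq_square mult.assoc)
qed

lemma A'_continuous: "continuous_on {0<..} A'"
proof -
  have "continuous_on {c..} A'" if "0 < c" for c
    unfolding A'_def
    by (intro continuous_on_minus continuous_on_lebesgue_integral[where b = "\<lambda>r. k r / c"])
       (use that square_rate_bound in \<open>auto simp: k_integrable intro!: continuous_intros\<close>)
  then have "isCont A' x" if "0 < x" for x
    using that continuous_on_interior[of "{x/2..}" A' x] by simp
  then show ?thesis by (simp add: continuous_on_eq_continuous_at)
qed

lemma A'_nonpos: "A' x \<le> 0"
  unfolding A'_def by simp

lemma A_has_derivative:
  assumes "0 < x" shows "(A has_real_derivative A' x) (at x)"
proof -
  \<comment> \<open>The half-line from \<open>x/2\<close> keeps away from 0, where the domination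
    may fail, and has \<open>x\<close> in its interior.\<close>
  have "(A has_real_derivative (\<integral>r. - ((k r)\<^sup>2 * exp (- k r * x)) \<partial>\<mu>)) (at x within {x/2..})"
    unfolding A_def
    by (rule has_real_derivative_lebesgue_integral[where b = "\<lambda>r. k r / (x/2)"])
       (use assms square_rate_bound[where c = "x/2"] integrable_A in
         \<open>auto simp: k_integrable power2_eq_square intro!: derivative_eq_intros\<close>)
  then have "(A has_real_derivative A' x) (at x within {x/2..})"
    by (simp add: A'_def)
  moreover have "x \<in> interior {x/2..}" using assms by simp
  ultimately show ?thesis using at_within_interior by metis
qed

lemma J_measurable [measurable]: "J \<in> borel_measurable borel"
proof -
  have "(\<lambda>x. indicator {0..} x *\<^sub>R A x) \<in> borel_measurable borel"
    using A_continuous by (intro borel_measurable_continuous_on_indicator) auto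
  moreover have "(\<lambda>x. indicator {0..} x *\<^sub>R A x) = J" by (auto simp: J_def fun_eq_iff)
  ultimately show ?thesis by simp
qed

end

section \<open>Convolution with the jump density\<close>

context rate_mixture begin

lemma phi_continuous: "continuous_on {0..} phi"
  by (rule DERIV_continuous_on[OF phi_has_derivative]) simp

lemma A_reflected_continuous: "continuous_on {0..x} (\<lambda>z. A (x - z))"
  by (rule continuous_on_compose2[OF A_continuous]) (auto intro!: continuous_intros)

lemma phi_reflected_continuous: "continuous_on {0..x} (\<lambda>z. phi (x - z))"
  by (rule continuous_on_compose2[OF phi_continuous]) (auto intro!: continuous_intros)

lemma phi_reflected_has_derivative:
  assumes "z < x" shows "((\<lambda>z. phi (x - z)) has_real_derivative A (x - z)) (at z)"
proof -
  have "(phi has_real_derivative - A (x - z)) (at (x - z) within {0..})"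
    using assms by (intro phi_has_derivative) simp
  moreover have "x - z \<in> interior {0..}" using assms by simp
  ultimately have "(phi has_real_derivative - A (x - z)) (at (x - z))"
    using at_within_interior by metis
  moreover have "((\<lambda>z. x - z) has_real_derivative - 1) (at z)"
    by (auto intro!: derivative_eq_intros)
  ultimately show ?thesis
    using DERIV_chain2[where f = phi and g = "\<lambda>z. x - z"] by fastforce
qed

lemma set_integrable_A_mult:
  assumes "continuous_on {0..x} R"
  shows "set_integrable lborel {0..x} (\<lambda>z. A (x - z) * R z)"
  using assms A_reflected_continuous by (intro borel_integrable_atLeastAtMost' continuous_intros)

text \<open>The product \<open>u z * phi (x - z)\<close> has derivative
  \<open>u' z * phi (x - z) + A (x - z) * u z\<close> inside the interval, and
  \<open>phi 0 = 1\<close>. The gauge integral needs only continuity of \<open>u\<close> at the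
  endpoints; \<open>int\<close> turns the result into a Lebesgue integral.\<close>

lemma CF_integral_by_parts:
  assumes x: "0 \<le> x" and u: "continuous_on {0..x} u"
    and u': "\<And>z. z \<in> {0<..<x} \<Longrightarrow> (u has_real_derivative u' z) (at z)"
    and int: "set_integrable lborel {0<..<x} (\<lambda>z. u' z * phi (x - z))"
  shows "(LBINT z:{0<..<x}. u' z * phi (x - z)) = u x - u 0 * phi x - (LBINT z:{0..x}. A (x - z) * u z)"
proof -
  have "((\<lambda>z. u' z * phi (x - z) + A (x - z) * u z) has_integral u x * phi (x - x) - u 0 * phi (x - 0)) {0..x}"
  proof (rule fundamental_theorem_of_calculus_interior[OF x])
    show "continuous_on {0..x} (\<lambda>z. u z * phi (x - z))"
      using u phi_reflected_continuous by (intro continuous_intros)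
    show "((\<lambda>z. u z * phi (x - z)) has_vector_derivative u' z * phi (x - z) + A (x - z) * u z) (at z)"
      if "z \<in> {0<..<x}" for z
      using that u'[OF that] phi_reflected_has_derivative[of z x]
      by (auto simp: has_real_derivative_iff_has_vector_derivative[symmetric] intro!: derivative_eq_intros)
  qed
  moreover have "((\<lambda>z. A (x - z) * u z) has_integral (LBINT z:{0..x}. A (x - z) * u z)) {0..x}"
    using set_borel_integral_eq_integral[OF set_integrable_A_mult[OF u]] by (simp add: has_integral_integral)
  ultimately have "((\<lambda>z. (u' z * phi (x - z) + A (x - z) * u z) - A (x - z) * u z) has_integral
      (u x * phi (x - x) - u 0 * phi (x - 0)) - (LBINT z:{0..x}. A (x - z) * u z)) {0..x}"
    by (rule has_integral_diff)
  then have "((\<lambda>z. u' z * phi (x - z)) has_integral u x - u 0 * phi x - (LBINT z:{0..x}. A (x - z) * u z)) {0<..<x}"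
    by (simp add: phi_0 has_integral_Icc_iff_Ioo)
  then show ?thesis
    using set_borel_integral_eq_integral[OF int] by (simp add: integral_unique)
qed

text \<open>Integration by parts for the constant function 1: the operator annihilates it.\<close>

lemma LBINT_A: 
  assumes "0 \<le> x" shows "(LBINT z:{0..x}. A (x - z)) = 1 - phi x"
  using CF_integral_by_parts[OF assms, of "\<lambda>_. 1" "\<lambda>_. 0"]
  by (simp add: set_integrable_def set_lebesgue_integral_def)

section \<open>Bounded causal functions and their convolution with \<open>J\<close>\<close>

definition causal :: "real \<Rightarrow> (real \<Rightarrow> real) \<Rightarrow> bool" where
  "causal B R \<longleftrightarrow> continuous_on {0..} R \<and> (\<forall>x<0. R x = 0) \<and> (\<forall>x. \<bar>R x\<bar> \<le> B)"

lemma causal_measurable: assumes "causal B R" shows "R \<in> borel_measurable borel"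
proof -
  have "(\<lambda>x. indicator {0..} x *\<^sub>R R x) \<in> borel_measurable borel"
    using assms by (intro borel_measurable_continuous_on_indicator) (auto simp: causal_def)
  moreover have "(\<lambda>x. indicator {0..} x *\<^sub>R R x) = R"
    using assms by (auto simp: causal_def fun_eq_iff indicator_def)
  ultimately show ?thesis by simp
qed

lemma causal_continuous: "causal B R \<Longrightarrow> continuous_on {0..x} R"
  unfolding causal_def by (auto intro: continuous_on_subset)

lemma J_causal: "causal K J"
proof -
  have "continuous_on {0..} J \<longleftrightarrow> continuous_on {0..} A"
    by (rule continuous_on_cong) (auto simp: J_def)
  then show ?thesis
    using A_continuous A_nonneg A_le_K K_nonneg by (auto simp: causal_def J_def)
qed

lemma conv_J_eq:
  assumes "\<And>z. z < 0 \<Longrightarrow> R z = 0"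
  shows "conv J R x = (LBINT z:{0..x}. A (x - z) * R z)"
  unfolding conv_def set_lebesgue_integral_def
  by (rule Bochner_Integration.integral_cong) (auto simp: J_def indicator_def assms not_le)

text \<open>By \<open>LBINT_A\<close>, \<open>A\<close> has mass \<open>1 - phi x\<close>, less than
  1, on \<open>{0..x}\<close>, so convolving with it does not increase a uniform bound.\<close>

lemma LBINT_A_bound:
  assumes x: "0 \<le> x" and R: "continuous_on {0..x} R" "\<And>z. z \<in> {0..x} \<Longrightarrow> \<bar>R z\<bar> \<le> B"
  shows "\<bar>LBINT z:{0..x}. A (x - z) * R z\<bar> \<le> B"
proof -
  have B: "0 \<le> B" using R(2)[of 0] x by auto
  have "\<bar>LBINT z:{0..x}. A (x - z) * R z\<bar> \<le> (LBINT z:{0..x}. A (x - z) * B)"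
    unfolding set_lebesgue_integral_def
  proof (rule integral_abs_bound_integral)
    show "integrable lborel (\<lambda>z. indicator {0..x} z *\<^sub>R (A (x - z) * R z))"
      using set_integrable_A_mult[OF R(1)] by (simp add: set_integrable_def)
    show "integrable lborel (\<lambda>z. indicator {0..x} z *\<^sub>R (A (x - z) * B))"
      using set_integrable_A_mult[of x "\<lambda>_. B"] by (simp add: set_integrable_def)
  qed (use R(2) A_nonneg B in \<open>auto simp: indicator_def abs_mult intro!: mult_left_mono\<close>)
  also have "\<dots> = (1 - phi x) * B" using LBINT_A[OF x] by simp
  also have "\<dots> \<le> 1 * B" using phi_pos[OF x] B by (intro mult_right_mono) auto
  finally show ?thesis by simp
qed

lemma conv_bound: assumes "causal B R" shows "\<bar>conv J R x\<bar> \<le> B"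
proof (cases "0 \<le> x")
  case True
  then show ?thesis
    using assms causal_continuous[OF assms] by (subst conv_J_eq) (auto simp: causal_def intro!: LBINT_A_bound)
next
  case False
  then show ?thesis
    using assms by (subst conv_J_eq) (auto simp: causal_def set_lebesgue_integral_def intro: order_trans[OF abs_ge_zero])
qed

section \<open>Convolution with \<open>J\<close> as a mixture of exponential convolutions\<close>

definition E :: "(real \<Rightarrow> real) \<Rightarrow> 'r \<Rightarrow> real \<Rightarrow> real" where
  "E R r x = (LBINT z:{0..x}. exp (- k r * (x - z)) * R z)"

definition H :: "(real \<Rightarrow> real) \<Rightarrow> real \<Rightarrow> real" where
  "H R x = (\<integral>r. (k r)\<^sup>2 * E R r x \<partial>\<mu>)"

lemma set_integrable_E:
  assumes "causal B R" shows "set_integrable lborel {0..x} (\<lambda>z. exp (- k r * (x - z)) * R z)"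
  using causal_continuous[OF assms] by (intro borel_integrable_atLeastAtMost' continuous_intros)

lemma E_measurable: assumes "causal B R" shows "(\<lambda>r. E R r x) \<in> borel_measurable \<mu>"
  using causal_measurable[OF assms, measurable] unfolding E_def set_lebesgue_integral_def
  by measurable

text \<open>Factoring out \<open>exp (- k r * y)\<close> leaves the integral of a function
  independent of \<open>y\<close>; this is variation of constants for the equation
  \<open>E' = R - k E\<close>.\<close>

lemma E_has_derivative:
  assumes R: "causal B R" and x: "0 \<le> x"
  shows "(E R r has_real_derivative R x - k r * E R r x) (at x within {0..})"
proof -
  have Eeq: "E R r y = exp (- k r * y) * integral {0..y} (\<lambda>z. exp (k r * z) * R z)" for y
    unfolding E_def set_borel_integral_eq_integral(2)[OF set_integrable_E[OF R]]
    by (subst integral_mult_right[symmetric]) (simp add: algebra_simps exp_add exp_diff exp_minus divide_simps)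
  have "((\<lambda>y. integral {0..y} (\<lambda>z. exp (k r * z) * R z)) has_real_derivative exp (k r * x) * R x) (at x within {0..x+1})"
    using x causal_continuous[OF R]
    by (intro integral_has_real_derivative continuous_intros) auto
  moreover have "at x within {0..x+1} = at x within {0..}"
    by (rule at_within_nhd[of _ "{..<x+1}"]) auto
  ultimately have "((\<lambda>y. integral {0..y} (\<lambda>z. exp (k r * z) * R z)) has_real_derivative exp (k r * x) * R x) (at x within {0..})"
    by simp
  then show ?thesis unfolding Eeq[abs_def]
    by (auto intro!: derivative_eq_intros simp: exp_minus field_simps)
qed

text \<open>The kernel \<open>k r * exp (- k r * z)\<close> has mass at most 1, so the bound is
  uniform in the rate.\<close>

lemma E_bound:
  assumes R: "causal B R" and x: "0 \<le> x" and r: "r \<in> space \<mu>"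
  shows "\<bar>k r * E R r x\<bar> \<le> B"
proof -
  have B: "0 \<le> B" using R by (auto simp: causal_def intro: order_trans[OF abs_ge_zero])
  have ce: "set_integrable lborel {0..x} (\<lambda>z. k r * exp (- k r * (x - z)) * B)"
    by (intro borel_integrable_atLeastAtMost' continuous_intros)
  have "\<bar>k r * E R r x\<bar> = \<bar>LBINT z:{0..x}. k r * (exp (- k r * (x - z)) * R z)\<bar>"
    unfolding E_def by simp
  also have "\<dots> \<le> (LBINT z:{0..x}. k r * exp (- k r * (x - z)) * B)"
    unfolding set_lebesgue_integral_def
  proof (rule integral_abs_bound_integral)
    show "integrable lborel (\<lambda>z. indicator {0..x} z *\<^sub>R (k r * (exp (- k r * (x - z)) * R z)))"
      using set_integrable_mult_right[of "k r", OF set_integrable_E[OF R]] by (simp add: set_integrable_def)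
    show "integrable lborel (\<lambda>z. indicator {0..x} z *\<^sub>R (k r * exp (- k r * (x - z)) * B))"
      using ce by (simp add: set_integrable_def)
  qed (use R k_nonneg[OF r] B in \<open>auto simp: causal_def indicator_def abs_mult mult.assoc intro!: mult_left_mono\<close>)
  also have "\<dots> = B - exp (- k r * x) * B"
  proof -
    have "((\<lambda>z. k r * exp (- k r * (x - z)) * B) has_integral exp (- k r * (x - x)) * B - exp (- k r * (x - 0)) * B) {0..x}"
      by (rule fundamental_theorem_of_calculus[OF x])
         (auto simp: has_real_derivative_iff_has_vector_derivative[symmetric] intro!: derivative_eq_intros)
    from integral_unique[OF this] show ?thesis unfolding set_borel_integral_eq_integral(2)[OF ce] by simp
  qed
  also have "\<dots> \<le> B" using B by simp
  finally show ?thesis .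
qed

text \<open>Fubini. The integrand is dominated by \<open>k r\<close> times a multiple of an
  indicator, which is integrable on the product because \<open>k\<close> has finite mean.\<close>

lemma conv_eq_mixture:
  assumes R: "causal B R"
  shows "conv J R x = (\<integral>r. k r * E R r x \<partial>\<mu>)"
proof -
  note [measurable] = causal_measurable[OF R]
  interpret L: pair_sigma_finite \<mu> lborel by standard
  define f where "f r z = indicator {0..x} z * (k r * exp (- k r * (x - z)) * R z)" for r z
  have ae: "\<bar>f r z\<bar> \<le> k r * (B * indicator {0..x} z)" if r: "r \<in> space \<mu>" for r z
  proof (cases "z \<in> {0..x}")
    case True
    then have "exp (- k r * (x - z)) * \<bar>R z\<bar> \<le> 1 * B"
      using R exp_rate_le_1[OF r, of "x - z"] by (intro mult_mono) (auto simp: causal_def)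
    from mult_left_mono[OF this k_nonneg[OF r]] show ?thesis
      using True k_nonneg[OF r] by (simp add: f_def abs_mult mult.assoc)
  qed (simp add: f_def)
  have cst: "integrable lborel (\<lambda>z. B * indicator {0..x} z)"
    using borel_integrable_atLeastAtMost'[of 0 x "\<lambda>_. B"] by (simp add: set_integrable_def mult.commute)
  have fm[measurable]: "case_prod f \<in> borel_measurable (\<mu> \<Otimes>\<^sub>M lborel)" unfolding f_def by measurable
  have fi: "integrable lborel (f r)" if "r \<in> space \<mu>" for r
  proof (rule Bochner_Integration.integrable_bound[OF integrable_mult_right[OF cst, of "k r"]])
    show "f r \<in> borel_measurable lborel" unfolding f_def by measurable
  qed (use ae[OF that] in \<open>auto intro!: AE_I2 intro: order_trans[OF _ abs_ge_self]\<close>)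
  have "integrable (\<mu> \<Otimes>\<^sub>M lborel) (case_prod f)"
  proof (rule L.Fubini_integrable[OF fm])
    have "integrable \<mu> (\<lambda>r. k r * (\<integral>z. B * indicator {0..x} z \<partial>lborel))" using k_integrable by simp
    then show "integrable \<mu> (\<lambda>r. \<integral>z. norm (case (r, z) of (r, z) \<Rightarrow> f r z) \<partial>lborel)"
    proof (rule Bochner_Integration.integrable_bound)
      show "AE r in \<mu>. norm (\<integral>z. norm (case (r, z) of (r, z) \<Rightarrow> f r z) \<partial>lborel)
         \<le> norm (k r * (\<integral>z. B * indicator {0..x} z \<partial>lborel))"
      proof (rule AE_I2)
        fix r assume r: "r \<in> space \<mu>"
        have "(\<integral>z. \<bar>f r z\<bar> \<partial>lborel) \<le> (\<integral>z. k r * (B * indicator {0..x} z) \<partial>lborel)"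
          using fi[OF r] cst ae[OF r] by (intro integral_mono) auto
        then show "norm (\<integral>z. norm (case (r, z) of (r, z) \<Rightarrow> f r z) \<partial>lborel)
         \<le> norm (k r * (\<integral>z. B * indicator {0..x} z \<partial>lborel))" by simp
      qed
    qed measurable
  qed (use fi in \<open>auto intro!: AE_I2\<close>)
  from L.Fubini_integral[OF this]
  have "(\<integral>z. (\<integral>r. f r z \<partial>\<mu>) \<partial>lborel) = (\<integral>r. (\<integral>z. f r z \<partial>lborel) \<partial>\<mu>)" .
  moreover have "(\<integral>r. f r z \<partial>\<mu>) = indicator {0..x} z *\<^sub>R (A (x - z) * R z)" for z
    by (simp add: f_def A_def indicator_def)
  moreover have "(\<integral>z. f r z \<partial>lborel) = k r * E R r x" for r
    unfolding E_def set_lebesgue_integral_def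
    by (subst Bochner_Integration.integral_mult_right_zero[symmetric])
       (auto simp: f_def ac_simps intro!: Bochner_Integration.integral_cong)
  ultimately show ?thesis
    using conv_J_eq[of R x] R by (simp add: causal_def set_lebesgue_integral_def)
qed

text \<open>One factor \<open>k r\<close> is absorbed by \<open>E_bound\<close> and the other is
  integrable, so the differentiated mixture is dominated without a second moment.\<close>

lemma square_E_bound:
  assumes "causal B R" "0 \<le> x" "r \<in> space \<mu>"
  shows "\<bar>(k r)\<^sup>2 * E R r x\<bar> \<le> k r * B"
  using mult_left_mono[OF E_bound[OF assms] k_nonneg[OF assms(3)]] k_nonneg[OF assms(3)]
  by (simp add: power2_eq_square abs_mult mult.assoc)

text \<open>Differentiating the exponentials of the mixture instead of \<^term>\<open>A\<close> avoids
  the possibly unbounded \<^term>\<open>A'\<close>.\<close>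

lemma conv_has_derivative:
  assumes R: "causal B R" and x: "0 \<le> x"
  shows "(conv J R has_real_derivative K * R x - H R x) (at x within {0..})"
proof -
  have sq: "integrable \<mu> (\<lambda>r. (k r)\<^sup>2 * E R r x)"
    by (rule Bochner_Integration.integrable_bound[OF integrable_mult_left[OF k_integrable, of B]])
       (use E_measurable[OF R] square_E_bound[OF R x] in \<open>auto intro: order_trans[OF _ abs_ge_self]\<close>)
  have "((\<lambda>x. \<integral>r. k r * E R r x \<partial>\<mu>) has_real_derivative (\<integral>r. k r * (R x - k r * E R r x) \<partial>\<mu>)) (at x within {0..})"
  proof (rule has_real_derivative_lebesgue_integral[where b = "\<lambda>r. k r * (B + B)"])
    show "integrable \<mu> (\<lambda>r. k r * E R r y)" if "y \<in> {0..}" for y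
      by (rule integrable_const_bound[where B = B]) (use that E_measurable[OF R] E_bound[OF R] in auto)
    show "(\<lambda>r. k r * (R x - k r * E R r x)) \<in> borel_measurable \<mu>"
      using E_measurable[OF R, measurable] by measurable
    show "\<bar>k r * (R y - k r * E R r y)\<bar> \<le> k r * (B + B)" if "r \<in> space \<mu>" "y \<in> {0..}" for r y
    proof -
      have "\<bar>R y\<bar> \<le> B" using R by (simp add: causal_def)
      with E_bound[OF R _ that(1), of y] that(2) have "\<bar>R y - k r * E R r y\<bar> \<le> B + B" by auto
      from mult_left_mono[OF this k_nonneg[OF that(1)]] show ?thesis
        using k_nonneg[OF that(1)] by (simp add: abs_mult)
    qed
  qed (use k_integrable x E_has_derivative[OF R] in \<open>auto intro!: DERIV_cmult\<close>)
  moreover have "(\<integral>r. k r * (R x - k r * E R r x) \<partial>\<mu>) = (\<integral>r. k r * R x - (k r)\<^sup>2 * E R r x \<partial>\<mu>)"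
    by (simp add: algebra_simps power2_eq_square)
  moreover have "\<dots> = K * R x - H R x"
    unfolding H_def K_def using k_integrable sq by simp
  ultimately show ?thesis unfolding conv_eq_mixture[OF R, abs_def] by simp
qed

lemma H_continuous: assumes R: "causal B R" shows "continuous_on {0..} (H R)"
  unfolding H_def
proof (rule continuous_on_lebesgue_integral[where b = "\<lambda>r. k r * B"])
  show "continuous_on {0..} (\<lambda>x. (k r)\<^sup>2 * E R r x)" for r
    by (intro continuous_intros DERIV_continuous_on[OF E_has_derivative[OF R]]) simp
qed (use k_integrable square_E_bound[OF R] E_measurable[OF R] in auto)

lemma conv_causal: assumes R: "causal B R" shows "causal B (conv J R)"
proof -
  have "continuous_on {0..} (conv J R)"
    by (rule DERIV_continuous_on[OF conv_has_derivative[OF R]]) simp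
  moreover have "conv J R x = 0" if "x < 0" for x
    using that R by (subst conv_J_eq) (auto simp: causal_def set_lebesgue_integral_def)
  ultimately show ?thesis using conv_bound[OF R] by (simp add: causal_def)
qed

end

section \<open>Flows controlled by their oscillation\<close>

text \<open>An abstract form of the difference of two solutions: \<open>S\<close> will be
  \<open>{0<..x}\<close> and \<open>D\<close> the operator applied to \<open>h\<close>. Every
  condition concerns a single time, with no uniformity in \<open>t\<close>. The factor 2 comes from
  \<open>CF_deriv_oscillation_bound\<close>.\<close>

locale oscillation_flow =
  fixes S :: "'i set" and h D :: "'i \<Rightarrow> real \<Rightarrow> real"
  assumes h_derivative: "\<And>x t. x \<in> S \<Longrightarrow> 0 \<le> t \<Longrightarrow> (h x has_real_derivative - D x t) (at t within {0..})"
    and D_bound: "\<And>x t B. x \<in> S \<Longrightarrow> 0 \<le> t \<Longrightarrow> (\<forall>y\<in>S. \<forall>z\<in>S. \<bar>h y t - h z t\<bar> \<le> B) \<Longrightarrow> \<bar>D x t\<bar> \<le> 2 * B"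
    and osc_finite: "\<And>t. 0 \<le> t \<Longrightarrow> \<exists>B. \<forall>y\<in>S. \<forall>z\<in>S. \<bar>h y t - h z t\<bar> \<le> B"
    and h_0: "\<And>x. x \<in> S \<Longrightarrow> h x 0 = 0"
begin

text \<open>A relation instead of a supremum, so that it makes sense before any finite bound is
  known.\<close>

definition osc_le :: "real \<Rightarrow> real \<Rightarrow> bool" where
  "osc_le t B \<longleftrightarrow> (\<forall>y\<in>S. \<forall>z\<in>S. \<bar>h y t - h z t\<bar> \<le> B)"

definition good :: "real \<Rightarrow> bool" where
  "good t \<longleftrightarrow> (\<exists>e>0. \<exists>B. \<forall>s\<ge>0. \<bar>s - t\<bar> < e \<longrightarrow> osc_le s B)"

lemma osc_le_mono: "osc_le t B \<Longrightarrow> B \<le> B' \<Longrightarrow> osc_le t B'"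
  unfolding osc_le_def by force

text \<open>Differences \<^term>\<open>\<lambda>t. h y t - h z t\<close> have slope at most four times the oscillation, so over
  a length of \<open>1/8\<close> they change by at most half of it.\<close>

lemma osc_le_doubling:
  assumes pq: "0 \<le> p" "q - p \<le> 1/8" and M: "\<And>t. t \<in> {p..q} \<Longrightarrow> osc_le t M"
    and \<tau>: "\<tau> \<in> {p..q}" "osc_le \<tau> B" and t: "t \<in> {p..q}"
  shows "osc_le t (2 * B)"
proof (cases "S = {}")
  case False
  define T where "T = {\<bar>h y s - h z s\<bar> |y z s. y \<in> S \<and> z \<in> S \<and> s \<in> {p..q}}"
  have bdd: "bdd_above T" using M by (auto simp: T_def osc_le_def intro!: bdd_aboveI[of _ M])
  have T_ne: "T \<noteq> {}" using False \<tau> by (auto simp: T_def)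
  have sup: "osc_le s (Sup T)" if "s \<in> {p..q}" for s
    unfolding osc_le_def by (intro ballI cSup_upper[OF _ bdd]) (use that in \<open>auto simp: T_def\<close>)
  \<comment> \<open>The supremum is finite by the bound \<open>M\<close>, so it can be absorbed:
    this inequality gives \<open>Sup T \<le> 2 * B\<close>, in which \<open>M\<close> no longer
    occurs.\<close>
  have "Sup T \<le> B + Sup T / 2"
  proof (rule cSup_least[OF T_ne])
    fix v assume "v \<in> T"
    then obtain y z s where v: "v = \<bar>h y s - h z s\<bar>" "y \<in> S" "z \<in> S" "s \<in> {p..q}"
      by (auto simp: T_def)
    have "norm ((h y s - h z s) - (h y \<tau> - h z \<tau>)) \<le> 4 * Sup T * norm (s - \<tau>)"
    proof (rule field_differentiable_bound[where S = "{p..q}"])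
      show "((\<lambda>t. h y t - h z t) has_real_derivative (- D y r - - D z r)) (at r within {p..q})"
        if "r \<in> {p..q}" for r
        using h_derivative v pq that
        by (intro DERIV_diff) (auto intro: DERIV_subset[where s = "{0..}"])
      show "norm (- D y r - - D z r) \<le> 4 * Sup T" if "r \<in> {p..q}" for r
        using D_bound[OF v(2) _ sup[OF that, unfolded osc_le_def]]
          D_bound[OF v(3) _ sup[OF that, unfolded osc_le_def]] pq that by auto
    qed (use v \<tau> in auto)
    also have "\<dots> \<le> 4 * Sup T * (1/8)"
    proof (rule mult_left_mono)
      have "p \<le> s" "s \<le> q" "p \<le> \<tau>" "\<tau> \<le> q" using v \<tau> by auto
      then show "norm (s - \<tau>) \<le> 1/8" using pq unfolding real_norm_def by linarith
      show "0 \<le> 4 * Sup T" using sup[OF \<tau>(1), unfolded osc_le_def, rule_format, of y y] v(2) by simp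
    qed
    finally have "\<bar>(h y s - h z s) - (h y \<tau> - h z \<tau>)\<bar> \<le> Sup T / 2" by simp
    moreover have "\<bar>h y \<tau> - h z \<tau>\<bar> \<le> B" using \<tau>(2) v by (simp add: osc_le_def)
    ultimately show "v \<le> B + Sup T / 2" unfolding v(1) by linarith
  qed
  with osc_le_mono[OF sup[OF t]] show ?thesis by simp
next
  case True
  then show ?thesis unfolding osc_le_def by blast
qed

section \<open>Local boundedness of the oscillation in time\<close>

lemma good_compact:
  assumes p: "0 \<le> p" and g: "\<And>t. t \<in> {p..q} \<Longrightarrow> good t"
  shows "\<exists>M. \<forall>t\<in>{p..q}. osc_le t M"
proof -
  obtain e B where e: "\<And>t. t \<in> {p..q} \<Longrightarrow> e t > 0"
    "\<And>t s. t \<in> {p..q} \<Longrightarrow> s \<ge> 0 \<Longrightarrow> \<bar>s - t\<bar> < e t \<Longrightarrow> osc_le s (B t)"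
    using g unfolding good_def by metis
  have "compact {p..q}" by simp
  moreover have "{p..q} \<subseteq> (\<Union>t\<in>{p..q}. ball t (e t))"
  proof
    fix t assume "t \<in> {p..q}"
    then show "t \<in> (\<Union>t\<in>{p..q}. ball t (e t))" using e(1)[of t] by (intro UN_I[of t]) auto
  qed
  ultimately obtain C where C: "C \<subseteq> {p..q}" "finite C" "{p..q} \<subseteq> (\<Union>t\<in>C. ball t (e t))"
    using compactE_image[of "{p..q}" "{p..q}" "\<lambda>t. ball t (e t)"] by (metis open_ball)
  show ?thesis
  proof (intro exI ballI)
    fix s assume s: "s \<in> {p..q}"
    then obtain t where t: "t \<in> C" "s \<in> ball t (e t)" using C by auto
    have "osc_le s (B t)"
      using t C s p by (intro e(2)) (auto simp: dist_real_def)
    moreover have "B t \<le> Max (B ` C)" using C t by simp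
    ultimately show "osc_le s (Max (B ` C))" by (rule osc_le_mono)
  qed
qed

text \<open>The time \<open>p\<close> itself may be bad. For \<open>s\<close> between
  \<open>p\<close> and \<open>q\<close>, distinct from \<open>p\<close>, the times from
  \<open>s\<close> to \<open>q\<close> are good, and doubling backwards from \<open>q\<close> bounds
  the oscillation at \<open>s\<close> by \<open>2 * B1\<close>, independently of \<open>s\<close>.
  The oscillation is then bounded on the whole interval, and doubling from \<open>p\<close> gives
  the bound in terms of \<open>B\<close> alone.\<close>

lemma osc_le_extend:
  assumes p: "0 \<le> p" and q: "0 \<le> q" and pq: "\<bar>p - q\<bar> \<le> 1/8"
    and g: "\<And>t. t \<in> {min p q..max p q} \<Longrightarrow> t \<noteq> p \<Longrightarrow> good t" and B: "osc_le p B"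
  shows "osc_le q (2 * B)"
proof -
  obtain B1 where B1: "osc_le q B1" using osc_finite[OF q] by (auto simp: osc_le_def)
  have *: "osc_le s (2 * B1)" if s: "s \<in> {min p q..max p q}" "s \<noteq> p" for s
  proof -
    have sub: "{min s q..max s q} \<subseteq> {min p q..max p q}" "p \<notin> {min s q..max s q} \<or> p = q" 
      using s by (auto simp: min_def max_def split: if_splits)
    have "p \<noteq> q" using s by auto
    have "0 \<le> min s q" using s p q by auto
    have "good t" if "t \<in> {min s q..max s q}" for t
      using g[of t] sub that \<open>p \<noteq> q\<close> by blast
    then obtain M where "\<forall>t\<in>{min s q..max s q}. osc_le t M"
      using good_compact[of "min s q" "max s q"] \<open>0 \<le> min s q\<close> by blast
    then show ?thesis
      using s p q pq B1
      by (intro osc_le_doubling[of "min s q" "max s q" M q B1]) (auto simp: min_def max_def split: if_splits)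
  qed
  have "osc_le t (max B (2 * B1))" if "t \<in> {min p q..max p q}" for t
    using *[of t] B that by (cases "t = p") (auto intro: osc_le_mono)
  then show ?thesis
    using p q pq B
    by (intro osc_le_doubling[of "min p q" "max p q" _ p B]) (auto simp: min_def max_def split: if_splits)
qed

text \<open>Each \<open>h y\<close> is continuous in time, so the set is an intersection of closed
  sets. This makes the sets \<open>U n\<close> in the Baire argument relatively open.\<close>

lemma closed_osc_le: "closed {t. 0 \<le> t \<and> osc_le t B}"
proof -
  have "continuous_on {0..} (h y)" if "y \<in> S" for y
    by (rule DERIV_continuous_on[OF h_derivative[OF that]]) simp
  then have "closed ({0..} \<inter> (\<lambda>t. \<bar>h y t - h z t\<bar>) -` {..B})" if "y \<in> S" "z \<in> S" for y z
    using that by (intro continuous_closed_preimage continuous_intros) auto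
  then have "closed (\<Inter>y\<in>S. \<Inter>z\<in>S. {0..} \<inter> (\<lambda>t. \<bar>h y t - h z t\<bar>) -` {..B})"
    by (intro closed_INT ballI)
  \<comment> \<open>The extra factor retains the half-line when \<open>S\<close> is empty and the
    intersection is everything.\<close>
  then have "closed ({0..} \<inter> (\<Inter>y\<in>S. \<Inter>z\<in>S. {0..} \<inter> (\<lambda>t. \<bar>h y t - h z t\<bar>) -` {..B}))"
    by (intro closed_Int closed_real_atLeast)
  moreover have "{0..} \<inter> (\<Inter>y\<in>S. \<Inter>z\<in>S. {0..} \<inter> (\<lambda>t. \<bar>h y t - h z t\<bar>) -` {..B}) = {t. 0 \<le> t \<and> osc_le t B}"
    by (auto simp: osc_le_def)
  ultimately show ?thesis by simp
qed

lemma closed_bad: "closed {t. 0 \<le> t \<and> \<not> good t}"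
proof -
  have "open {t. good t}"
    unfolding open_dist
  proof (intro ballI)
    fix t assume "t \<in> {t. good t}"
    then obtain e B where e: "e > 0" "\<And>s. s \<ge> 0 \<Longrightarrow> \<bar>s - t\<bar> < e \<Longrightarrow> osc_le s B"
      unfolding good_def by auto
    have "good u" if "dist u t < e / 2" for u
    proof -
      have "osc_le s B" if "0 \<le> s" "\<bar>s - u\<bar> < e / 2" for s
        using that \<open>dist u t < e / 2\<close> unfolding dist_real_def by (intro e(2)) linarith+
      then show ?thesis unfolding good_def using e(1) by (intro exI[of _ "e / 2"] conjI exI[of _ B]) auto
    qed
    then show "\<exists>e>0. \<forall>y. dist y t < e \<longrightarrow> y \<in> {t. good t}"
      using e(1) by (intro exI[of _ "e/2"]) auto
  qed
  then have "closed ({0..} \<inter> - {t. good t})" by (intro closed_Int closed_Compl) auto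
  moreover have "{0..} \<inter> - {t. good t} = {t. 0 \<le> t \<and> \<not> good t}" by auto
  ultimately show ?thesis by simp
qed

text \<open>The oscillation is finite at each time, but nothing bounds it locally in time a priori.
  By Baire's theorem it is bounded on a portion of the set of bad times; it at most doubles on the
  good gaps in between, so the portion consists of good times.\<close>

lemma all_good:
  assumes "0 \<le> t" shows "good t"
proof (rule ccontr)
  define F where "F = {t. 0 \<le> t \<and> \<not> good t}"
  define U where "U n = F \<inter> - {t. 0 \<le> t \<and> osc_le t (real n)}" for n
  have Fcl: "closed F" using closed_bad by (simp add: F_def)
  assume "\<not> good t"
  then have "t \<in> F" using assms by (simp add: F_def)
  \<comment> \<open>If all \<open>U n\<close> were dense in the closed set \<open>F\<close>, Baire
    would make their intersection dense in \<open>F\<close>. It is empty, because the oscillation is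
    finite at each time.\<close>
  have "\<exists>n. \<not> F \<subseteq> closure (U n)"
  proof (rule ccontr)
    assume "\<not> ?thesis"
    moreover have "openin (top_of_set F) (U n)" for n
      unfolding U_def using closed_osc_le by (intro openin_open_Int open_Compl)
    ultimately have "F \<subseteq> closure (\<Inter>(range U))"
      using Fcl by (intro Baire) auto
    moreover have "\<Inter>(range U) = {}"
    proof -
      have "\<exists>n. s \<notin> U n" for s
      proof (cases "0 \<le> s")
        case True
        then obtain B where "osc_le s B" using osc_finite[OF True] by (auto simp: osc_le_def)
        moreover obtain n where "B \<le> real n" using real_arch_simple by blast
        ultimately show ?thesis using True by (auto simp: U_def intro: osc_le_mono)
      qed (auto simp: U_def F_def)
      then show ?thesis by auto
    qed
    ultimately show False using \<open>t \<in> F\<close> by simp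
  qed
  then obtain n t0 where t0: "t0 \<in> F" "t0 \<notin> closure (U n)" by auto
  then obtain e0 where e0: "e0 > 0" "\<And>s. dist s t0 < e0 \<Longrightarrow> s \<notin> U n"
    unfolding closure_approachable by auto
  \<comment> \<open>The cap \<open>1/8\<close> lets a single doubling step reach \<open>s\<close>
    from any point between \<open>s\<close> and \<open>t0\<close>.\<close>
  define e where "e = min e0 (1/8)"
  have Fb: "osc_le s (real n)" if "s \<in> F" "\<bar>s - t0\<bar> < e" for s
    using e0(2)[of s] that by (auto simp: U_def F_def e_def dist_real_def)
  have "osc_le s (2 * real n)" if s: "0 \<le> s" "\<bar>s - t0\<bar> < e" for s
  proof -
    define G where "G = F \<inter> {min s t0..max s t0}"
    have G: "compact G" "G \<noteq> {}"
      unfolding G_def using Fcl t0(1) by (auto intro: closed_Int_compact)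
    \<comment> \<open>The bad time nearest to \<open>s\<close> on the side of \<open>t0\<close>; it
      exists since \<open>t0\<close> lies in \<open>G\<close>. All times from \<open>r\<close> to
      \<open>s\<close> other than \<open>r\<close> are good, so the bound at \<open>r\<close>
      extends to \<open>s\<close>.\<close>
    obtain r where r: "r \<in> G" "\<And>y. y \<in> G \<Longrightarrow> \<bar>s - r\<bar> \<le> \<bar>s - y\<bar>"
      using distance_attains_inf[of G s] compact_imp_closed[OF G(1)] G(2) by (auto simp: dist_real_def)
    then have rb: "min s t0 \<le> r" "r \<le> max s t0" by (auto simp: G_def)
    have "0 \<le> r" using r(1) by (simp add: G_def F_def)
    have e8: "e \<le> 1/8" by (simp add: e_def)
    show ?thesis
    proof (rule osc_le_extend)
      show "0 \<le> r" by fact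
      show "\<bar>r - s\<bar> \<le> 1/8" using rb e8 s by linarith
      show "osc_le r (real n)" 
      proof (rule Fb)
        show "r \<in> F" using r(1) by (simp add: G_def)
        show "\<bar>r - t0\<bar> < e" using rb s by linarith
      qed
      show "good u" if u: "u \<in> {min r s..max r s}" "u \<noteq> r" for u
      proof (rule ccontr)
        assume "\<not> good u"
        have ub: "min r s \<le> u" "u \<le> max r s" using u(1) by auto
        have "0 \<le> u" using ub s \<open>0 \<le> r\<close> by linarith
        moreover have "min s t0 \<le> u" "u \<le> max s t0" using ub rb by linarith+
        ultimately have "u \<in> G" using \<open>\<not> good u\<close> by (simp add: G_def F_def)
        from r(2)[OF this] have "u = r" using ub by linarith
        with u(2) show False by simp
      qed
    qed fact
  qed
  then have "good t0" unfolding good_def using e0(1) by (intro exI[of _ e]) (auto simp: e_def)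
  then show False using t0(1) by (simp add: F_def)
qed

text \<open>The initial oscillation is zero, and steps of length \<open>1/8\<close> at most double
  it.\<close>

lemma osc_zero: "0 \<le> t \<Longrightarrow> osc_le t 0"
proof -
  have "\<forall>t\<in>{0..real n / 8}. osc_le t 0" for n
  proof (induction n)
    case 0
    show ?case using h_0 by (auto simp: osc_le_def)
  next
    case (Suc n)
    have "osc_le t 0" if "t \<in> {0..real (Suc n) / 8}" "\<not> t \<le> real n / 8" for t
      using osc_le_extend[of "real n / 8" t 0] that Suc all_good by (auto simp: field_simps)
    with Suc show ?case by auto
  qed
  moreover assume "0 \<le> t"
  moreover obtain n where "t * 8 \<le> real n" using real_arch_simple by blast
  ultimately show ?thesis by (auto simp: field_simps)
qed

text \<open>With zero oscillation, \<open>D_bound\<close> gives \<open>D = 0\<close>, so each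
  \<open>h x\<close> keeps its initial value.\<close>

lemma flow_zero:
  assumes x: "x \<in> S" and t: "0 \<le> t" shows "h x t = 0"
proof -
  have "D x s = 0" if "0 \<le> s" for s
    using D_bound[OF x that osc_zero[OF that, unfolded osc_le_def]] by simp
  then have "(h x has_real_derivative 0) (at s within {0..})" if "s \<in> {0..}" for s
    using h_derivative[OF x, of s] that by simp
  then have "\<exists>c. \<forall>s\<in>{0..}. h x s = c"
    by (intro has_field_derivative_zero_constant) auto
  then show ?thesis using h_0[OF x] t by force
qed

end

section \<open>The convolution series\<close>

lemma summable_exp_weights: "summable (\<lambda>n. \<bar>t ^ (n + m) / fact (n + m)\<bar>)" for t :: real
proof -
  have "summable (\<lambda>n. inverse (fact n) * \<bar>t\<bar> ^ n)" by (rule summable_exp)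
  then have "summable (\<lambda>n. inverse (fact (n + m)) * \<bar>t\<bar> ^ (n + m))"
    by (rule summable_ignore_initial_segment)
  then show ?thesis by (simp add: divide_inverse abs_mult power_abs mult.commute)
qed

text \<open>A continuous derivative is bounded by some \<open>L\<close> on \<open>{a..b}\<close>, so
  \<open>F\<close> is Lipschitz there and \<open>\<epsilon> / L\<close> serves as \<delta>.\<close>

lemma AC_loc_posI:
  assumes der: "\<And>x. 0 < x \<Longrightarrow> (F has_real_derivative F' x) (at x)"
    and cont: "continuous_on {0<..} F'"
  shows "AC_loc_pos F"
  unfolding AC_loc_pos_def abs_continuous_on_Icc_def
proof (intro allI impI)
  fix a b \<epsilon> :: real assume ab: "0 < a \<and> a \<le> b" and \<epsilon>: "0 < \<epsilon>"
  have "continuous_on {a..b} F'" using cont ab by (auto intro: continuous_on_subset)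
  then have "bounded (F' ` {a..b})" by (intro compact_imp_bounded compact_continuous_image) auto
  then obtain L where L: "0 < L" "\<And>x. x \<in> {a..b} \<Longrightarrow> \<bar>F' x\<bar> \<le> L"
    unfolding bounded_pos by auto
  have lip: "\<bar>F u - F l\<bar> \<le> L * (u - l)" if "a \<le> l" "l \<le> u" "u \<le> b" for l u
  proof -
    have "norm (F u - F l) \<le> L * norm (u - l)"
      by (rule field_differentiable_bound[where S = "{a..b}" and f' = F'])
         (use that ab L der in \<open>auto intro: has_field_derivative_at_within\<close>)
    then show ?thesis using that by simp
  qed
  show "\<exists>\<delta>>0. \<forall>(n::nat) l u. (\<forall>i<n. a \<le> l i \<and> l i \<le> u i \<and> u i \<le> b) \<and>
      disjoint_family_on (\<lambda>i. {l i<..<u i}) {..<n} \<and> (\<Sum>i<n. u i - l i) < \<delta> \<longrightarrow>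
      (\<Sum>i<n. \<bar>F (u i) - F (l i)\<bar>) < \<epsilon>"
  proof (intro exI[of _ "\<epsilon> / L"] conjI allI impI)
    fix n :: nat and l u :: "nat \<Rightarrow> real"
    assume H: "(\<forall>i<n. a \<le> l i \<and> l i \<le> u i \<and> u i \<le> b) \<and>
      disjoint_family_on (\<lambda>i. {l i<..<u i}) {..<n} \<and> (\<Sum>i<n. u i - l i) < \<epsilon> / L"
    have "(\<Sum>i<n. \<bar>F (u i) - F (l i)\<bar>) \<le> (\<Sum>i<n. L * (u i - l i))"
      using H lip by (intro sum_mono) auto
    also have "\<dots> = L * (\<Sum>i<n. u i - l i)" by (simp add: sum_distrib_left)
    also have "\<dots> < L * (\<epsilon> / L)" using H L(1) by (intro mult_strict_left_mono) auto
    finally show "(\<Sum>i<n. \<bar>F (u i) - F (l i)\<bar>) < \<epsilon>" using L(1) by simp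
  qed (use \<epsilon> L in simp)
qed

context rate_mixture begin

section \<open>Convolution powers of the jump density\<close>

definition c :: "nat \<Rightarrow> real \<Rightarrow> real" where "c n = conv_power J (Suc n)"

lemma c_0: "c 0 = J" by (simp add: c_def conv_power_def)

lemma c_Suc: "c (Suc n) = conv J (c n)" by (simp add: c_def conv_power_def)

text \<open>Convolution with \<open>J\<close> preserves the bound, so all powers share
  \<open>K\<close>; this dominates every series below by its weights.\<close>

lemma c_causal: "causal K (c n)"
  by (induction n) (simp_all add: c_0 c_Suc J_causal conv_causal)

lemma c_bound: "\<bar>c n x\<bar> \<le> K" using c_causal[of n] by (simp add: causal_def)

lemma c_nonneg: "0 \<le> c n x"
proof (induction n arbitrary: x)
  case (Suc n)
  then show ?case unfolding c_Suc conv_def by (intro integral_nonneg_AE) (auto simp: J_def A_nonneg)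
qed (simp add: c_0 J_def A_nonneg)

lemma c_neg: "x < 0 \<Longrightarrow> c n x = 0" using c_causal[of n] by (simp add: causal_def)

text \<open>The convolution integral at 0 runs over the null set \<open>{0}\<close>. Hence only the
  single-jump term contributes to the boundary value \<open>S t 0\<close>.\<close>

lemma c_Suc_at_0: "c (Suc n) 0 = 0"
  unfolding c_Suc by (subst conv_J_eq) (auto simp: c_neg set_lebesgue_integral_def intro!: integral_eq_zero_AE AE_I[where N = "{0}"] simp: indicator_def)

lemma conv_integrable:
  assumes "causal B R" shows "integrable lborel (\<lambda>y. J (x - y) * R y)"
proof -
  have "set_integrable lborel {0..x} (\<lambda>z. A (x - z) * R z)"
    by (rule set_integrable_A_mult[OF causal_continuous[OF assms]])
  moreover have "(\<lambda>z. indicator {0..x} z *\<^sub>R (A (x - z) * R z)) = (\<lambda>y. J (x - y) * R y)"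
    using assms by (auto simp: J_def indicator_def causal_def fun_eq_iff)
  ultimately show ?thesis by (simp add: set_integrable_def)
qed

lemma summable_c: "summable (\<lambda>n. \<bar>w n\<bar>) \<Longrightarrow> summable (\<lambda>n. \<bar>w n * c n x\<bar>)"
  by (rule summable_comparison_test'[of "\<lambda>n. \<bar>w n\<bar> * K" 0])
     (auto simp: abs_mult c_bound intro!: summable_mult2 mult_left_mono)

lemma series_causal:
  assumes w: "summable (\<lambda>n. \<bar>w n\<bar>)"
  shows "causal ((\<Sum>n. \<bar>w n\<bar>) * K) (\<lambda>x. \<Sum>n. w n * c n x)"
  unfolding causal_def
proof (intro conjI allI impI)
  have "uniform_limit {0..} (\<lambda>n x. \<Sum>i<n. w i * c i x) (\<lambda>x. \<Sum>n. w n * c n x) sequentially"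
    by (rule Weierstrass_m_test[where M = "\<lambda>n. \<bar>w n\<bar> * K"])
       (use w in \<open>auto simp: abs_mult c_bound intro!: summable_mult2 mult_left_mono\<close>)
  then show "continuous_on {0..} (\<lambda>x. \<Sum>n. w n * c n x)"
    by (rule uniform_limit_theorem[rotated])
       (use c_causal in \<open>auto simp: causal_def intro!: always_eventually continuous_intros\<close>)
next
  fix x
  have "\<bar>\<Sum>n. w n * c n x\<bar> \<le> (\<Sum>n. \<bar>w n * c n x\<bar>)" using summable_rabs[OF summable_c[OF w]] .
  also have "\<dots> \<le> (\<Sum>n. \<bar>w n\<bar> * K)"
    using w summable_c[OF w] by (intro suminf_le) (auto simp: abs_mult c_bound intro!: summable_mult2 mult_left_mono)
  also have "\<dots> = (\<Sum>n. \<bar>w n\<bar>) * K" using w by (rule suminf_mult2[symmetric])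
  finally show "\<bar>\<Sum>n. w n * c n x\<bar> \<le> (\<Sum>n. \<bar>w n\<bar>) * K" .
qed (simp add: c_neg)

text \<open>Sum and integral may be exchanged: as \<open>J\<close> and \<open>c n\<close> are
  nonnegative, the norms integrate to \<open>\<bar>w n\<bar> * c (Suc n) x\<close>, which is
  summable by the uniform bound \<open>K\<close>.\<close>

lemma conv_series:
  assumes w: "summable (\<lambda>n. \<bar>w n\<bar>)"
  shows "conv J (\<lambda>x. \<Sum>n. w n * c n x) x = (\<Sum>n. w n * c (Suc n) x)"
proof -
  have sc: "summable (\<lambda>n. w n * c n y)" for y
    by (rule summable_rabs_cancel[OF summable_c[OF w]])
  have "conv J (\<lambda>x. \<Sum>n. w n * c n x) x = (\<integral>y. (\<Sum>n. w n * (J (x - y) * c n y)) \<partial>lborel)"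
  proof -
    have "J (x - y) * (\<Sum>n. w n * c n y) = (\<Sum>n. w n * (J (x - y) * c n y))" for y
      using suminf_mult[OF sc, of "J (x - y)" y] by (simp add: mult.left_commute)
    then show ?thesis unfolding conv_def by simp
  qed
  also have "\<dots> = (\<Sum>n. \<integral>y. w n * (J (x - y) * c n y) \<partial>lborel)"
  proof (rule integral_suminf)
    show "integrable lborel (\<lambda>y. w n * (J (x - y) * c n y))" for n
      using conv_integrable[OF c_causal] by simp
    have "summable (\<lambda>n. J (x - y) * \<bar>w n * c n y\<bar>)" for y
      using summable_c[OF w] by (rule summable_mult)
    then show "AE y in lborel. summable (\<lambda>n. norm (w n * (J (x - y) * c n y)))"
      by (simp add: abs_mult J_def A_nonneg mult.left_commute)
    have "(\<integral>y. norm (w n * (J (x - y) * c n y)) \<partial>lborel) = \<bar>w n\<bar> * c (Suc n) x" for n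
      by (simp add: abs_mult J_def A_nonneg c_nonneg c_Suc conv_def if_distrib cong: if_cong)
    then show "summable (\<lambda>n. \<integral>y. norm (w n * (J (x - y) * c n y)) \<partial>lborel)"
      using w by (auto simp: c_nonneg intro!: summable_comparison_test'[of "\<lambda>n. \<bar>w n\<bar> * K" 0] summable_mult2 mult_left_mono)
         (metis abs_ge_self c_bound order_trans)
  qed
  also have "\<dots> = (\<Sum>n. w n * c (Suc n) x)" by (simp add: c_Suc conv_def)
  finally show ?thesis .
qed

section \<open>The series and its derivatives in time and space\<close>

definition S :: "real \<Rightarrow> real \<Rightarrow> real" where
  "S t x = (\<Sum>n. t ^ Suc n / fact (Suc n) * c n x)"

text \<open>Here \<open>c n\<close> carries the weight that \<open>c (Suc n)\<close> has in
  \<open>S\<close>. So \<open>conv J (R t)\<close> is the part of \<open>S t\<close> with at least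
  two jumps, to which \<open>conv_has_derivative\<close> applies.\<close>

definition R :: "real \<Rightarrow> real \<Rightarrow> real" where
  "R t x = (\<Sum>n. t ^ Suc (Suc n) / fact (Suc (Suc n)) * c n x)"

lemma S_weights: "summable (\<lambda>n. \<bar>t ^ Suc n / fact (Suc n)\<bar>)" for t :: real
  using summable_exp_weights[of t 1] by simp

lemma R_weights: "summable (\<lambda>n. \<bar>t ^ Suc (Suc n) / fact (Suc (Suc n))\<bar>)" for t :: real
  using summable_exp_weights[of t 2] by (simp del: fact_Suc power_Suc)

lemmas S_causal = series_causal[OF S_weights, folded S_def]
lemmas R_causal = series_causal[OF R_weights, folded R_def]

lemma density_eq_S: "compound_poisson_density J x t = exp (- t) * S t x"
  by (simp add: compound_poisson_density_def S_def c_def)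

lemma S_nonneg: "0 \<le> t \<Longrightarrow> 0 \<le> S t x"
  unfolding S_def using summable_rabs_cancel[OF summable_c[OF S_weights]]
  by (intro suminf_nonneg) (auto simp: c_nonneg)

lemma S_eq_J_conv: "S t x = t * J x + conv J (R t) x"
proof -
  have "summable (\<lambda>n. t ^ Suc n / fact (Suc n) * c n x)"
    by (rule summable_rabs_cancel[OF summable_c[OF S_weights]])
  from suminf_split_head[OF this] show ?thesis
    unfolding S_def R_def conv_series[OF R_weights] by (simp add: c_0)
qed

lemma S_at_0: "S t 0 = t * K"
proof -
  have "summable (\<lambda>n. t ^ Suc n / fact (Suc n) * c n 0)"
    by (rule summable_rabs_cancel[OF summable_c[OF S_weights]])
  from suminf_split_head[OF this] show ?thesis
    by (simp add: S_def c_Suc_at_0 c_0 J_def A_0)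
qed

lemma S_time_derivative: "((\<lambda>t. S t x) has_real_derivative J x + conv J (S t) x) (at t)"
proof -
  \<comment> \<open>The coefficients of \<open>S\<close> as a power series in time; the zero
    coefficient vanishes because the case of no jump belongs to the atom.\<close>
  define s where "s n = (case n of 0 \<Rightarrow> 0 | Suc m \<Rightarrow> c m x / fact (Suc m))" for n
  have sm: "summable (\<lambda>n. s n * u ^ n)" for u
    using summable_rabs_cancel[OF summable_c[OF S_weights[of u]], of x]
    by (subst summable_Suc_iff[symmetric]) (simp add: s_def mult.commute del: fact_Suc power_Suc)
  have "S u x = (\<Sum>n. s n * u ^ n)" for u
    using suminf_split_head[OF sm, of u] by (simp add: S_def s_def mult.commute del: fact_Suc power_Suc)
  moreover have "diffs s n = c n x / fact n" for n
    by (simp add: diffs_def s_def del: of_nat_Suc)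
  then have "(\<Sum>n. diffs s n * t ^ n) = J x + conv J (S t) x"
  proof -
    have sm0: "summable (\<lambda>n. t ^ n / fact n * c n x)"
      using summable_exp_weights[of t 0] by (intro summable_rabs_cancel[OF summable_c]) simp
    assume "\<And>n. diffs s n = c n x / fact n"
    then have "(\<Sum>n. diffs s n * t ^ n) = (\<Sum>n. t ^ n / fact n * c n x)" by (simp add: mult.commute)
    also have "\<dots> = J x + (\<Sum>n. t ^ Suc n / fact (Suc n) * c (Suc n) x)"
      using suminf_split_head[OF sm0] by (simp add: c_0)
    also have "\<dots> = J x + conv J (S t) x"
      unfolding S_def[abs_def] conv_series[OF S_weights] ..
    finally show ?thesis .
  qed
  ultimately show ?thesis
    using termdiffs_strong_converges_everywhere[of s t, OF sm] by simp
qed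

text \<open>The first summand carries the possible singularity at 0; the bracket is continuous on
  \<open>{0..}\<close>.\<close>

definition S' :: "real \<Rightarrow> real \<Rightarrow> real" where
  "S' t x = t * A' x + (K * R t x - H (R t) x)"

lemma S_space_derivative: assumes x: "0 < x" shows "(S t has_real_derivative S' t x) (at x)"
proof -
  have "(conv J (R t) has_real_derivative K * R t x - H (R t) x) (at x within {0..})"
    using x by (intro conv_has_derivative[OF R_causal]) simp
  moreover have "at x within {0..} = at x" using x by (intro at_within_interior) simp
  moreover have "(J has_real_derivative A' x) (at x)"
    by (rule has_field_derivative_transform_within_open[OF A_has_derivative[OF x], of "{0<..}"])
       (use x in \<open>auto simp: J_def\<close>)
  ultimately show ?thesis
    unfolding S_eq_J_conv[abs_def] S'_def by (auto intro!: derivative_eq_intros)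
qed

lemma S'_regular_part_continuous: "continuous_on {0..} (\<lambda>x. K * R t x - H (R t) x)"
  using R_causal[of t] H_continuous[OF R_causal, of t] by (auto simp: causal_def intro!: continuous_intros)

lemma S'_continuous: "continuous_on {0<..} (S' t)"
  unfolding S'_def
  by (intro continuous_intros A'_continuous continuous_on_subset[OF S'_regular_part_continuous]) auto

text \<open>Although \<open>A'\<close> may be unbounded near 0, it has constant sign and its
  primitive \<open>A\<close> has finite limits at both ends, so the fundamental theorem for
  nonnegative integrands applies to \<open>- A'\<close>.\<close>

lemma A'_integrable: assumes x: "0 < x" shows "set_integrable lborel {0<..<x} A'"
proof -
  have "set_integrable lborel (einterval (ereal 0) (ereal x)) (\<lambda>z. - A' z)"
  proof (rule interval_integral_FTC_nonneg[where F = "\<lambda>z. - A z" and A = "- A 0" and B = "- A x"])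
    have "continuous_on {0..x} A" using A_continuous by (auto intro: continuous_on_subset)
    then have "(A \<longlongrightarrow> A 0) (at_right 0)" "(A \<longlongrightarrow> A x) (at_left x)"
      using x by (auto dest: continuous_on_Icc_at_rightD continuous_on_Icc_at_leftD)
    then show "(((\<lambda>z. - A z) \<circ> real_of_ereal) \<longlongrightarrow> - A 0) (at_right (ereal 0))"
      "(((\<lambda>z. - A z) \<circ> real_of_ereal) \<longlongrightarrow> - A x) (at_left (ereal x))"
      by (auto simp: ereal_tendsto_simps intro: tendsto_minus)
    show "isCont (\<lambda>z. - A' z) z" if "ereal 0 < ereal z" for z
      using A'_continuous that by (intro continuous_minus) (auto simp: continuous_on_eq_continuous_at)
  qed (use x A'_nonpos A_has_derivative in \<open>auto intro!: DERIV_minus\<close>)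
  then have "set_integrable lborel {0<..<x} (\<lambda>z. - A' z)" by simp
  from set_integrable_mult_right[of "-1", OF this] show ?thesis by simp
qed

section \<open>Integrability with and without the kernel\<close>

lemma phi_measurable [measurable]: "phi \<in> borel_measurable borel"
  unfolding phi_def by measurable

lemma set_integrable_mult_phi:
  assumes "set_integrable lborel {0<..<x} w"
  shows "set_integrable lborel {0<..<x} (\<lambda>z. w z * phi (x - z))"
proof -
  have w: "integrable lborel (\<lambda>z. indicator {0<..<x} z * w z)" using assms by (simp add: set_integrable_def)
  have [measurable]: "(\<lambda>z. indicator {0<..<x} z * w z) \<in> borel_measurable borel"
    using borel_measurable_integrable[OF w] by simp
  have "integrable lborel (\<lambda>z. (indicator {0<..<x} z * w z) * phi (x - z))"
  proof (rule Bochner_Integration.integrable_bound[OF w])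
    show "(\<lambda>z. (indicator {0<..<x} z * w z) * phi (x - z)) \<in> borel_measurable lborel" by measurable
    have "\<bar>phi (x - z)\<bar> \<le> 1" if "z \<in> {0<..<x}" for z
      using that phi_le_1[of "x - z"] phi_pos[of "x - z"] by auto
    then show "AE z in lborel. norm (indicator {0<..<x} z * w z * phi (x - z)) \<le> norm (indicator {0<..<x} z * w z)"
      by (intro AE_I2) (auto simp: indicator_def abs_mult intro!: mult_left_le)
  qed
  then show ?thesis by (simp add: set_integrable_def mult.assoc)
qed

text \<open>On the interval \<open>1 / phi (x - z)\<close> is at most \<open>1 / phi x\<close>, by
  positivity and monotonicity of \<open>phi\<close>. So the domain of the operator forces the
  derivative itself to be integrable up to 0.\<close>

lemma set_integrable_div_phi:
  assumes x: "0 < x" and int: "set_integrable lborel {0<..<x} (\<lambda>z. w z * phi (x - z))"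
  shows "set_integrable lborel {0<..<x} w"
proof -
  define v where "v z = indicator {0<..<x} z * (w z * phi (x - z))" for z
  have v: "integrable lborel v" using int by (simp add: set_integrable_def v_def[abs_def])
  have [measurable]: "v \<in> borel_measurable borel" using borel_measurable_integrable[OF v] by simp
  have "integrable lborel (\<lambda>z. v z / phi (x - z))"
  proof (rule Bochner_Integration.integrable_bound[OF integrable_mult_left[OF v, of "1 / phi x"]])
    show "(\<lambda>z. v z / phi (x - z)) \<in> borel_measurable lborel" by measurable
    have "\<bar>v z / phi (x - z)\<bar> \<le> \<bar>v z * (1 / phi x)\<bar>" for z
    proof (cases "z \<in> {0<..<x}")
      case True
      then have "0 < phi x" "phi x \<le> phi (x - z)" using x by (auto intro: phi_pos phi_antimono)
      then show ?thesis by (auto simp: abs_mult intro!: divide_left_mono)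
    qed (simp add: v_def)
    then show "AE z in lborel. norm (v z / phi (x - z)) \<le> norm (v z * (1 / phi x))" by simp
  qed
  moreover have "v z / phi (x - z) = indicator {0<..<x} z *\<^sub>R w z" for z
    using phi_pos[of "x - z"] by (auto simp: v_def indicator_def)
  ultimately show ?thesis by (simp add: set_integrable_def)
qed

lemma S'_integrable: assumes x: "0 < x" shows "set_integrable lborel {0<..<x} (S' t)"
  unfolding S'_def
proof (rule set_integral_add(1))
  show "set_integrable lborel {0<..<x} (\<lambda>z. t * A' z)" using A'_integrable[OF x] by simp
  have "set_integrable lborel {0..x} (\<lambda>z. K * R t z - H (R t) z)"
    by (intro borel_integrable_atLeastAtMost' continuous_on_subset[OF S'_regular_part_continuous]) auto
  then show "set_integrable lborel {0<..<x} (\<lambda>z. K * R t z - H (R t) z)"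
    by (rule set_integrable_subset) auto
qed

end

section \<open>The equation\<close>

text \<open>Connects the operator and the inhomogeneities of the equation with the mixture; the
  three identities are checked in the final theorem, where the measure is the law of
  \<alpha>.\<close>

locale cf_mixture = rate_mixture +
  fixes q :: "real \<Rightarrow> real"
  assumes kernel: "CF_kernel q = phi" and A_q: "A_q q = A" and B_q: "B_q q = (\<lambda>x. K * phi x)"
begin

section \<open>The density as a solution\<close>

definition f :: "real \<Rightarrow> real \<Rightarrow> real" where
  "f = compound_poisson_density (jump_density q)"

lemma f_eq: "f x t = exp (- t) * S t x"
proof -
  have "jump_density q = J" by (simp add: fun_eq_iff jump_density_def J_def A_q)
  then show ?thesis by (simp add: f_def density_eq_S)
qed

lemma f_space_derivative: "0 < x \<Longrightarrow> ((\<lambda>x. f x t) has_real_derivative exp (- t) * S' t x) (at x)"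
  unfolding f_eq by (intro DERIV_cmult S_space_derivative)

lemma deriv_integrable_f:
  assumes "0 < x"
  shows "set_integrable lborel {0<..<x} (\<lambda>z. exp (- t) * S' t z * phi (x - z))"
  using S'_integrable[OF assms, of t] by (intro set_integrable_mult_phi) simp

lemma deriv_f: "0 < x \<Longrightarrow> deriv (\<lambda>x. f x t) x = exp (- t) * S' t x"
  using f_space_derivative by (rule DERIV_imp_deriv)

lemma CF_domain_f: "CF_domain q (\<lambda>x. f x t)"
  unfolding CF_domain_def kernel
proof (intro conjI allI impI)
  show "(\<lambda>x. f x t) differentiable (at x)" if "0 < x" for x
    using f_space_derivative[OF that] by (auto simp: real_differentiable_def)
  show "AC_loc_pos (\<lambda>x. f x t)"
    using S'_continuous by (intro AC_loc_posI[OF f_space_derivative]) (auto intro!: continuous_intros)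
  show "set_integrable lborel {0<..<x} (\<lambda>z. deriv (\<lambda>x. f x t) z * phi (x - z))" if "0 < x" for x
  proof -
    have "set_integrable lborel {0<..<x} (\<lambda>z. deriv (\<lambda>x. f x t) z * phi (x - z))
      \<longleftrightarrow> set_integrable lborel {0<..<x} (\<lambda>z. exp (- t) * S' t z * phi (x - z))"
      by (rule set_integrable_cong) (auto simp: deriv_f)
    then show ?thesis using deriv_integrable_f[OF that] by simp
  qed
qed

lemma CF_deriv_f:
  assumes x: "0 \<le> x"
  shows "CF_deriv q (\<lambda>y. f y t) x = exp (- t) * (S t x - t * K * phi x - conv J (S t) x)"
proof -
  have cont: "continuous_on {0..x} (S t)" by (rule causal_continuous[OF S_causal])
  have "CF_deriv q (\<lambda>y. f y t) x = (LBINT z:{0<..<x}. exp (- t) * S' t z * phi (x - z))"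
    unfolding CF_deriv_def kernel by (rule set_lebesgue_integral_cong) (auto simp: deriv_f)
  also have "\<dots> = exp (- t) * S t x - exp (- t) * S t 0 * phi x - (LBINT z:{0..x}. A (x - z) * (exp (- t) * S t z))"
  proof (rule CF_integral_by_parts[OF x])
    show "set_integrable lborel {0<..<x} (\<lambda>z. exp (- t) * S' t z * phi (x - z))"
      using deriv_integrable_f[of x t] x by (cases "x = 0") (auto simp: set_integrable_def)
  qed (use S_space_derivative cont in \<open>auto intro!: DERIV_cmult continuous_intros\<close>)
  also have "(LBINT z:{0..x}. A (x - z) * (exp (- t) * S t z)) = exp (- t) * (LBINT z:{0..x}. A (x - z) * S t z)"
    by (subst set_integral_mult_right[symmetric]) (simp add: mult.left_commute)
  also have "(LBINT z:{0..x}. A (x - z) * S t z) = conv J (S t) x"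
    using S_causal[of t] by (subst conv_J_eq) (auto simp: causal_def)
  finally show ?thesis by (simp add: S_at_0 algebra_simps)
qed

text \<open>The series is an entire power series in \<open>t\<close>, so the derivative is two-sided
  and restricts to every \<open>X\<close>.\<close>

lemma f_time_derivative:
  assumes "0 \<le> x"
  shows "((\<lambda>s. f x s) has_real_derivative
           - CF_deriv q (\<lambda>y. f y t) x + exp (- t) * A_q q x - t * exp (- t) * B_q q x) (at t within X)"
proof -
  have "((\<lambda>s. f x s) has_real_derivative - exp (- t) * S t x + exp (- t) * (J x + conv J (S t) x)) (at t)"
    unfolding f_eq by (rule derivative_eq_intros S_time_derivative refl)+ simp
  moreover have "- exp (- t) * S t x + exp (- t) * (J x + conv J (S t) x)
      = - CF_deriv q (\<lambda>y. f y t) x + exp (- t) * A_q q x - t * exp (- t) * B_q q x"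
    using assms by (simp add: CF_deriv_f A_q B_q J_def algebra_simps)
  ultimately show ?thesis by (auto intro: has_field_derivative_at_within)
qed

lemma f_0: "f x 0 = 0" by (simp add: f_eq S_def)

lemma CF_solution_f: "CF_solution q f"
  unfolding CF_solution_def using CF_domain_f f_time_derivative
  by (simp add: f_0)

section \<open>Uniqueness: the operator controlled by the oscillation\<close>

definition regular :: "(real \<Rightarrow> real) \<Rightarrow> bool" where
  "regular F \<longleftrightarrow> (\<forall>x>0. F differentiable (at x)) \<and>
     (\<forall>x>0. set_integrable lborel {0<..<x} (\<lambda>z. deriv F z * phi (x - z)))"

lemma regular_has_derivative:
  assumes "regular F" "0 < z" shows "(F has_real_derivative deriv F z) (at z)"
proof -
  have "F differentiable (at z)" using assms unfolding regular_def by blast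
  then show ?thesis by (rule DERIV_deriv_iff_real_differentiable[THEN iffD2])
qed

lemma CF_domain_imp_regular: "CF_domain q F \<Longrightarrow> regular F"
  unfolding CF_domain_def regular_def kernel by (elim conjE) (rule conjI)

text \<open>Integrability of the defining integral of the operator makes \<^term>\<open>F\<close> absolutely
  continuous up to \<open>0\<close>, with boundary value \<^term>\<open>a\<close>, which need not be \<^term>\<open>F 0\<close>.\<close>

lemma regular_primitive:
  assumes F: "regular F" and x: "0 < x"
  shows "\<exists>a u. continuous_on {0..x} u \<and> u 0 = 0 \<and> (\<forall>y\<in>{0<..x}. F y = a + u y)"
proof (intro exI conjI ballI)
  have "set_integrable lborel {0<..<x} (\<lambda>z. deriv F z * phi (x - z))"
    using F[unfolded regular_def, THEN conjunct2, rule_format, OF x] .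
  then have w: "set_integrable lborel {0<..<x} (deriv F)"
    by (rule set_integrable_div_phi[OF x])
  have int: "deriv F integrable_on {0..x}"
    using set_borel_integral_eq_integral(1)[OF w] unfolding integrable_on_Icc_iff_Ioo .
  define u where "u = (\<lambda>y. integral {0..y} (deriv F))"
  show "continuous_on {0..x} u"
    unfolding u_def by (rule indefinite_integral_continuous_1[OF int])
  show "u 0 = 0" by (simp add: u_def)
  fix y assume y: "y \<in> {0<..x}"
  have "(deriv F has_integral (F x - F y)) {y..x}"
  proof (rule fundamental_theorem_of_calculus)
    show "(F has_vector_derivative deriv F z) (at z within {y..x})" if "z \<in> {y..x}" for z
      unfolding has_real_derivative_iff_has_vector_derivative[symmetric]
      by (rule has_field_derivative_at_within[OF regular_has_derivative[OF F]]) (use y that in simp)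
  qed (use y in simp)
  from integral_unique[OF this] have "integral {y..x} (deriv F) = F x - F y" .
  moreover have "u y + integral {y..x} (deriv F) = u x"
    unfolding u_def by (rule Henstock_Kurzweil_Integration.integral_combine[OF _ _ int]) (use y in auto)
  \<comment> \<open>The constant \<open>a\<close> is \<open>F x - u x\<close>, the same for all
    \<open>y\<close>.\<close>
  ultimately show "F y = (F x - u x) + u y" by linarith
qed

lemma regular_oscillation_finite:
  assumes "regular F" "0 < x"
  shows "\<exists>B. \<forall>y\<in>{0<..x}. \<forall>z\<in>{0<..x}. \<bar>F y - F z\<bar> \<le> B"
proof -
  obtain a u where u: "continuous_on {0..x} u" "u 0 = 0" "\<forall>y\<in>{0<..x}. F y = a + u y"
    using regular_primitive[OF assms] by blast
  have "bounded (u ` {0..x})" using u(1) by (intro compact_imp_bounded compact_continuous_image) auto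
  then obtain B where "\<forall>y\<in>{0..x}. \<bar>u y\<bar> \<le> B" unfolding bounded_iff by auto
  then have "\<bar>F y - F z\<bar> \<le> B + B" if "y \<in> {0<..x}" "z \<in> {0<..x}" for y z
  proof -
    have "\<bar>u y\<bar> \<le> B" "\<bar>u z\<bar> \<le> B" using \<open>\<forall>y\<in>{0..x}. \<bar>u y\<bar> \<le> B\<close> that by auto
    then show ?thesis using bspec[OF u(3) that(1)] bspec[OF u(3) that(2)] by linarith
  qed
  then show ?thesis by blast
qed

text \<open>Replacing \<open>F\<close> by \<open>u\<close> removes the boundary term, since
  \<open>u 0 = 0\<close>, and leaves \<open>u x\<close> minus the convolution of \<open>A\<close>
  with \<open>u\<close>. Letting \<open>z\<close> tend to 0 in \<open>u y - u z\<close> bounds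
  \<open>u\<close> by \<open>B\<close>, hence each of the two terms by \<open>B\<close>.\<close>

lemma CF_deriv_oscillation_bound:
  assumes F: "regular F" and x: "0 < x" and B: "\<And>y z. y \<in> {0<..x} \<Longrightarrow> z \<in> {0<..x} \<Longrightarrow> \<bar>F y - F z\<bar> \<le> B"
  shows "\<bar>CF_deriv q F x\<bar> \<le> 2 * B"
proof -
  obtain a u where u: "continuous_on {0..x} u" "u 0 = 0" "\<forall>y\<in>{0<..x}. F y = a + u y"
    using regular_primitive[OF F x] by blast
  have lim: "(u \<longlongrightarrow> 0) (at_right 0)"
    using continuous_on_Icc_at_rightD[OF u(1) x] u(2) by simp
  have ub: "\<bar>u y\<bar> \<le> B" if y: "y \<in> {0..x}" for y
  proof (cases "y = 0")
    case False
    have "\<bar>u y - 0\<bar> \<le> B"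
    proof (rule tendsto_upperbound)
      show "((\<lambda>z. \<bar>u y - u z\<bar>) \<longlongrightarrow> \<bar>u y - 0\<bar>) (at_right 0)" by (intro tendsto_intros lim)
      have "\<bar>u y - u z\<bar> \<le> B" if "z \<in> {0<..<x}" for z
      proof -
        have yz: "y \<in> {0<..x}" "z \<in> {0<..x}" using that y False by auto
        show ?thesis using B[OF yz] bspec[OF u(3) yz(1)] bspec[OF u(3) yz(2)] by linarith
      qed
      then show "\<forall>\<^sub>F z in at_right 0. \<bar>u y - u z\<bar> \<le> B"
        using x by (auto simp: eventually_at_right_field)
    qed simp
    then show ?thesis by simp
  next
    case True
    then show ?thesis using B[of x x] x u(2) by simp
  qed
  have "CF_deriv q F x = u x - u 0 * phi x - (LBINT z:{0..x}. A (x - z) * u z)"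
    unfolding CF_deriv_def kernel
  proof (rule CF_integral_by_parts)
    show "(u has_real_derivative deriv F z) (at z)" if z: "z \<in> {0<..<x}" for z
    proof -
      have "(F has_real_derivative deriv F z) (at z)"
        using z by (intro regular_has_derivative[OF F]) simp
      then have "((\<lambda>y. F y - a) has_real_derivative deriv F z) (at z)"
        by (auto intro!: derivative_eq_intros)
      then show ?thesis
        by (rule has_field_derivative_transform_within_open[of _ _ _ "{0<..<x}"]) (use z u(3) in auto)
    qed
  qed (use F x u(1) in \<open>auto simp: regular_def\<close>)
  moreover have "\<bar>LBINT z:{0..x}. A (x - z) * u z\<bar> \<le> B"
    using x u(1) ub by (intro LBINT_A_bound) auto
  moreover have "\<bar>u x\<bar> \<le> B" using ub[of x] x by simp
  ultimately show ?thesis unfolding u(2) by simp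
qed

lemma regular_diff:
  assumes F: "regular F" and G: "regular G"
  shows "regular (\<lambda>x. F x - G x)"
    and "0 < x \<Longrightarrow> CF_deriv q (\<lambda>x. F x - G x) x = CF_deriv q F x - CF_deriv q G x"
proof -
  have eq: "deriv (\<lambda>x. F x - G x) z * phi (x - z) = deriv F z * phi (x - z) - deriv G z * phi (x - z)"
    if "0 < z" for x z
    using DERIV_imp_deriv[OF DERIV_diff[OF regular_has_derivative[OF F that] regular_has_derivative[OF G that]]]
    by (simp add: left_diff_distrib)
  have int: "set_integrable lborel {0<..<x} (\<lambda>z. deriv (\<lambda>x. F x - G x) z * phi (x - z))"
    "(LBINT z:{0<..<x}. deriv (\<lambda>x. F x - G x) z * phi (x - z))
      = (LBINT z:{0<..<x}. deriv F z * phi (x - z)) - (LBINT z:{0<..<x}. deriv G z * phi (x - z))"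
    if x: "0 < x" for x
  proof -
    have FG: "set_integrable lborel {0<..<x} (\<lambda>z. deriv F z * phi (x - z))"
      "set_integrable lborel {0<..<x} (\<lambda>z. deriv G z * phi (x - z))"
      using F G x by (simp_all add: regular_def)
    have "set_integrable lborel {0<..<x} (\<lambda>z. deriv (\<lambda>x. F x - G x) z * phi (x - z))
      \<longleftrightarrow> set_integrable lborel {0<..<x} (\<lambda>z. deriv F z * phi (x - z) - deriv G z * phi (x - z))"
      by (rule set_integrable_cong) (auto simp: eq)
    with set_integral_diff(1)[OF FG]
    show "set_integrable lborel {0<..<x} (\<lambda>z. deriv (\<lambda>x. F x - G x) z * phi (x - z))" by simp
    have "(LBINT z:{0<..<x}. deriv (\<lambda>x. F x - G x) z * phi (x - z))
      = (LBINT z:{0<..<x}. deriv F z * phi (x - z) - deriv G z * phi (x - z))"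
      by (rule set_lebesgue_integral_cong) (auto simp: eq)
    with set_integral_diff(2)[OF FG]
    show "(LBINT z:{0<..<x}. deriv (\<lambda>x. F x - G x) z * phi (x - z))
      = (LBINT z:{0<..<x}. deriv F z * phi (x - z)) - (LBINT z:{0<..<x}. deriv G z * phi (x - z))" by simp
  qed
  show "regular (\<lambda>x. F x - G x)"
    unfolding regular_def
  proof (intro conjI allI impI int(1))
    show "(\<lambda>x. F x - G x) differentiable (at x)" if "0 < x" for x
      using F G that by (intro differentiable_diff) (simp_all add: regular_def)
  qed
  show "CF_deriv q (\<lambda>x. F x - G x) x = CF_deriv q F x - CF_deriv q G x" if "0 < x"
    using int(2)[OF that] by (simp add: CF_deriv_def kernel)
qed

text \<open>At \<open>x = 0\<close> the operator integrates over an empty interval, so the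
  difference is constant in time. For positive \<open>x\<close> the flow argument runs on
  \<open>{0<..x}\<close>; it leaves out 0, where a solution may differ from its right limit.\<close>

theorem CF_solution_unique:
  assumes g: "CF_solution q g" and x: "0 \<le> x" and t: "0 \<le> t"
  shows "g x t = f x t"
proof -
  define h where "h x t = g x t - f x t" for x t
  define D where "D x t = CF_deriv q (\<lambda>y. h y t) x" for x t
  have dom: "regular (\<lambda>x. g x t)" "regular (\<lambda>x. f x t)" if "0 \<le> t" for t
    using g that CF_domain_f by (auto simp: CF_solution_def intro!: CF_domain_imp_regular)
  have dom_h: "regular (\<lambda>x. h x t)" if "0 \<le> t" for t
    unfolding h_def using dom[OF that] by (rule regular_diff(1))
  have D_eq: "D x t = CF_deriv q (\<lambda>x. g x t) x - CF_deriv q (\<lambda>x. f x t) x" if "0 \<le> t" "0 \<le> x" for x t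
  proof (cases "x = 0")
    case True
    then show ?thesis by (simp add: D_def CF_deriv_def set_lebesgue_integral_def)
  next
    case False
    then show ?thesis using regular_diff(2)[OF dom[OF that(1)]] that by (simp add: D_def h_def)
  qed
  have der: "(h x has_real_derivative - D x t) (at t within {0..})" if "0 \<le> x" "0 \<le> t" for x t
  proof -
    have "((\<lambda>s. g x s) has_real_derivative
           - CF_deriv q (\<lambda>y. g y t) x + exp (- t) * A_q q x - t * exp (- t) * B_q q x) (at t within {0..})"
      using g that by (simp add: CF_solution_def)
    from DERIV_diff[OF this f_time_derivative[OF that(1)]] show ?thesis
      using D_eq[OF that(2,1)] by (simp add: h_def[abs_def])
  qed
  have h0: "h x 0 = 0" if "0 \<le> x" for x
    using g that CF_solution_f by (simp add: CF_solution_def h_def)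
  have "h x t = 0"
  proof (cases "x = 0")
    case True
    have "D 0 s = 0" for s by (simp add: D_def CF_deriv_def set_lebesgue_integral_def)
    then have "(h 0 has_real_derivative 0) (at s within {0..})" if "s \<in> {0..}" for s
      using der[of 0 s] that by simp
    then obtain a where a: "\<And>s. s \<in> {0..} \<Longrightarrow> h 0 s = a"
      using has_field_derivative_zero_constant[of "{0..}" "h 0"] by (meson convex_real_interval(1))
    show ?thesis using a[of 0] a[of t] h0[of 0] True t by simp
  next
    case False
    with x have x: "0 < x" by simp
    interpret oscillation_flow "{0<..x}" h D
    proof
      show "\<bar>D y t\<bar> \<le> 2 * B"
        if "y \<in> {0<..x}" "0 \<le> t" "\<forall>y\<in>{0<..x}. \<forall>z\<in>{0<..x}. \<bar>h y t - h z t\<bar> \<le> B" for y t B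
        unfolding D_def using that by (intro CF_deriv_oscillation_bound dom_h) auto
      show "\<exists>B. \<forall>y\<in>{0<..x}. \<forall>z\<in>{0<..x}. \<bar>h y t - h z t\<bar> \<le> B" if "0 \<le> t" for t
        using regular_oscillation_finite[OF dom_h[OF that] x] .
    qed (use der h0 in auto)
    show ?thesis using flow_zero[of x t] x t by simp
  qed
  then show ?thesis by (simp add: h_def)
qed

end

section \<open>The compound Poisson process\<close>

context prob_space begin

text \<open>Almost surely \<open>N 0 = 0\<close>, so \<open>N t\<close> is the increment from time
  0. The case \<open>t = 0\<close> is separate because the increment law is stated for
  \<open>s < t\<close>.\<close>

lemma poisson_process_prob:
  assumes N: "poisson_process 1 N" and t: "0 \<le> t"
  shows "prob {\<omega> \<in> space M. N t \<omega> = n} = exp (- t) * (t ^ n / fact n)"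
proof -
  have meas: "N s \<in> M \<rightarrow>\<^sub>M count_space UNIV" if "0 \<le> s" for s
    using N that by (simp add: poisson_process_def)
  note [measurable] = meas[OF t] meas[OF order_refl]
  have N0: "AE \<omega> in M. N 0 \<omega> = 0" using N by (auto simp: poisson_process_def)
  show ?thesis
  proof (cases "t = 0")
    case True
    have "prob {\<omega> \<in> space M. N t \<omega> = n} = (if n = 0 then 1 else 0)"
    proof (cases "n = 0")
      case True
      then show ?thesis using N0 \<open>t = 0\<close> by (simp add: prob_eq_1)
    next
      case False
      then have "AE \<omega> in M. \<omega> \<notin> {\<omega> \<in> space M. N t \<omega> = n}" using N0 \<open>t = 0\<close> by auto
      then show ?thesis using False by (simp add: prob_eq_0)
    qed
    then show ?thesis using True by simp
  next
    case False
    with t have t: "0 < t" by simp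
    have D: "distr M (count_space UNIV) (\<lambda>\<omega>. N t \<omega> - N 0 \<omega>) = measure_pmf (poisson_pmf t)"
      using N t unfolding poisson_process_def by (metis diff_zero mult_1 order_refl)
    have "prob {\<omega> \<in> space M. N t \<omega> = n} = prob ((\<lambda>\<omega>. N t \<omega> - N 0 \<omega>) -` {n} \<inter> space M)"
      by (rule measure_eq_AE) (use N0 in auto)
    also have "\<dots> = measure (measure_pmf (poisson_pmf t)) {n}"
      unfolding D[symmetric] by (subst measure_distr) auto
    also have "\<dots> = exp (- t) * (t ^ n / fact n)"
      using t by (simp add: measure_pmf_single)
    finally show ?thesis .
  qed
qed

text \<open>The first event reads one coordinate of the path of \<open>N\<close>, the second
  finitely many jumps, so each lies in one of the two independent sigma-algebras.\<close>

lemma indep_process_sequence_prob: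
  assumes ind: "indep_process_sequence N X" and t: "0 \<le> t"
  shows "prob {\<omega> \<in> space M. N t \<omega> = n \<and> (\<Sum>j=1..n. X j \<omega>) \<le> y}
    = prob {\<omega> \<in> space M. N t \<omega> = n} * prob {\<omega> \<in> space M. (\<Sum>j=1..n. X j \<omega>) \<le> y}"
proof -
  define P1 where "P1 = PiM {0..} (\<lambda>_::real. count_space (UNIV :: nat set))"
  define P2 where "P2 = PiM {1..} (\<lambda>_::nat. borel :: real measure)"
  define V1 where "V1 = vimage_algebra (space M) (\<lambda>\<omega>. \<lambda>t\<in>{0..}. N t \<omega>) P1"
  define V2 where "V2 = vimage_algebra (space M) (\<lambda>\<omega>. \<lambda>j\<in>{1..}. X j \<omega>) P2"
  have sp[simp]: "space V1 = space M" "space V2 = space M" by (simp_all add: V1_def V2_def)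
  have m1: "(\<lambda>\<omega>. \<lambda>t\<in>{0..}. N t \<omega>) \<in> V1 \<rightarrow>\<^sub>M P1" unfolding V1_def
    by (rule measurable_vimage_algebra1) (auto simp: P1_def space_PiM)
  have m2: "(\<lambda>\<omega>. \<lambda>j\<in>{1..}. X j \<omega>) \<in> V2 \<rightarrow>\<^sub>M P2" unfolding V2_def
    by (rule measurable_vimage_algebra1) (auto simp: P2_def space_PiM)
  have "(\<lambda>\<omega>. (\<lambda>t\<in>{0..}. N t \<omega>) t) \<in> V1 \<rightarrow>\<^sub>M count_space UNIV"
    using measurable_compose[OF m1, of "\<lambda>f. f t"] t by (simp add: P1_def)
  then have [measurable]: "N t \<in> V1 \<rightarrow>\<^sub>M count_space UNIV" using t by simp
  have X[measurable]: "X j \<in> V2 \<rightarrow>\<^sub>M borel" if "j \<in> {1..n}" for j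
    using measurable_compose[OF m2, of "\<lambda>f. f j"] that by (simp add: P2_def)
  have "{\<omega> \<in> space V1. N t \<omega> = n} \<in> sets V1" by measurable
  moreover have "{\<omega> \<in> space V2. (\<Sum>j=1..n. X j \<omega>) \<le> y} \<in> sets V2" by measurable
  moreover have "indep_set (sets V1) (sets V2)"
    using ind by (simp add: indep_process_sequence_def V1_def V2_def P1_def P2_def)
  ultimately have "prob ({\<omega> \<in> space M. N t \<omega> = n} \<inter> {\<omega> \<in> space M. (\<Sum>j=1..n. X j \<omega>) \<le> y})
    = prob {\<omega> \<in> space M. N t \<omega> = n} * prob {\<omega> \<in> space M. (\<Sum>j=1..n. X j \<omega>) \<le> y}"
    using indep_setD by simp
  moreover have "{\<omega> \<in> space M. N t \<omega> = n} \<inter> {\<omega> \<in> space M. (\<Sum>j=1..n. X j \<omega>) \<le> y}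
    = {\<omega> \<in> space M. N t \<omega> = n \<and> (\<Sum>j=1..n. X j \<omega>) \<le> y}" by auto
  ultimately show ?thesis by simp
qed

lemma distributed_prob_atMost:
  fixes g :: "real \<Rightarrow> real"
  assumes Y: "distributed M lborel Y (\<lambda>x. ennreal (g x))" and g: "\<And>x. 0 \<le> g x" "g \<in> borel_measurable borel"
  shows "integrable lborel g" "(\<integral>x. g x \<partial>lborel) = 1"
    and "prob {\<omega> \<in> space M. Y \<omega> \<le> y} = (LBINT x:{..y}. g x)"
proof -
  have tot: "(\<integral>\<^sup>+x. ennreal (g x) \<partial>lborel) = 1"
    using distributed_emeasure[OF Y, of UNIV] by (simp add: emeasure_space_1)
  show int: "integrable lborel g"
    using g tot by (intro integrableI_nonneg) auto
  show "(\<integral>x. g x \<partial>lborel) = 1"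
    using tot g nn_integral_eq_integral[OF int] by simp
  have "emeasure M (Y -` {..y} \<inter> space M) = (\<integral>\<^sup>+x. ennreal (g x) * indicator {..y} x \<partial>lborel)"
    by (rule distributed_emeasure[OF Y]) simp
  also have "\<dots> = (\<integral>\<^sup>+x. ennreal (indicator {..y} x * g x) \<partial>lborel)"
    by (intro nn_integral_cong) (auto simp: indicator_def)
  also have "\<dots> = ennreal (LBINT x:{..y}. g x)"
    unfolding set_lebesgue_integral_def using int g
    by (subst nn_integral_eq_integral) (auto intro!: integrable_mult_indicator[of "{..y}" lborel g, simplified])
  finally have "prob (Y -` {..y} \<inter> space M) = (LBINT x:{..y}. g x)"
    using g by (simp add: measure_def set_lebesgue_integral_def)
  then show "prob {\<omega> \<in> space M. Y \<omega> \<le> y} = (LBINT x:{..y}. g x)"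
    by (simp add: vimage_def Int_def conj_commute)
qed

end

context rate_mixture begin

text \<open>Each induction step adds one independent jump. The nonnegative integral agrees with
  \<open>conv\<close> at every point, so the density is the version \<open>c n\<close>
  itself.\<close>

lemma distributed_partial_sum:
  assumes "prob_space M" and ind: "prob_space.indep_vars M (\<lambda>_. borel) X {1..}"
    and X: "\<And>j. 1 \<le> j \<Longrightarrow> distributed M lborel (X j) (\<lambda>x. ennreal (J x))"
  shows "distributed M lborel (\<lambda>\<omega>. \<Sum>j=1..Suc n. X j \<omega>) (\<lambda>x. ennreal (c n x))"
proof -
  interpret M: prob_space M by fact
  show ?thesis
  proof (induction n)
    case 0
    then show ?case using X[of 1] by (simp add: c_0)
  next
    case (Suc n)
    have "M.indep_var borel (X (Suc (Suc n))) borel (\<lambda>\<omega>. \<Sum>j\<in>{1..Suc n}. X j \<omega>)"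
      by (rule M.indep_vars_sum) (auto intro: M.indep_vars_subset[OF ind])
    from M.distributed_convolution[OF this X Suc]
    have "distributed M lborel (\<lambda>\<omega>. X (Suc (Suc n)) \<omega> + (\<Sum>j=1..Suc n. X j \<omega>))
      (\<lambda>x. \<integral>\<^sup>+y. ennreal (J (x - y)) * ennreal (c n y) \<partial>lborel)" by simp
    moreover have "(\<integral>\<^sup>+y. ennreal (J (x - y)) * ennreal (c n y) \<partial>lborel) = ennreal (c (Suc n) x)" for x
    proof -
      have "(\<integral>\<^sup>+y. ennreal (J (x - y)) * ennreal (c n y) \<partial>lborel) = (\<integral>\<^sup>+y. ennreal (J (x - y) * c n y) \<partial>lborel)"
        by (intro nn_integral_cong ennreal_mult[symmetric]) (auto simp: J_def A_nonneg c_nonneg)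
      also have "\<dots> = ennreal (conv J (c n) x)"
        unfolding conv_def using conv_integrable[OF c_causal]
        by (intro nn_integral_eq_integral) (auto simp: J_def A_nonneg c_nonneg)
      finally show ?thesis by (simp add: c_Suc)
    qed
    ultimately show ?case by (simp add: add.commute)
  qed
qed

text \<open>Split according to the value of \<open>N t\<close>: the value 0 yields the atom, and the
  value \<open>Suc n\<close> yields the term with \<open>c n\<close>, by independence. The series is
  then integrated termwise.\<close>

lemma ac_component_density_compound_sum:
  assumes M: "prob_space M" and N: "prob_space.poisson_process M 1 N"
    and ind: "prob_space.indep_vars M (\<lambda>_. borel) X {1..}"
    and X: "\<And>j. 1 \<le> j \<Longrightarrow> distributed M lborel (X j) (\<lambda>x. ennreal (J x))"
    and NX: "prob_space.indep_process_sequence M N X" and t: "0 \<le> t"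
  shows "prob_space.ac_component_density M (exp (- t)) (compound_sum N X t)
    (\<lambda>x. compound_poisson_density J x t)"
proof -
  interpret M: prob_space M by fact
  define w where "w n = exp (- t) * (t ^ n / fact n)" for n
  have w: "0 \<le> w n" for n using t by (simp add: w_def)
  have "summable (\<lambda>n. \<bar>t ^ Suc n / fact (Suc n)\<bar>)" by (rule S_weights)
  then have sw: "summable (\<lambda>n. w (Suc n))"
    unfolding w_def using t by (intro summable_mult) simp
  note c_meas[measurable] = causal_measurable[OF c_causal]
  note dist = distributed_partial_sum[OF M ind X]
  note c_int = M.distributed_prob_atMost[OF dist c_nonneg c_meas]
  have X_meas: "X j \<in> borel_measurable M" if "1 \<le> j" for j
    using distributed_measurable[OF X[OF that]] by simp
  have N_meas[measurable]: "N t \<in> M \<rightarrow>\<^sub>M count_space UNIV"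
    using N t by (simp add: M.poisson_process_def)
  have sum_meas[measurable]: "(\<lambda>\<omega>. \<Sum>j=1..n. X j \<omega>) \<in> borel_measurable M" for n
    using X_meas by (intro borel_measurable_sum) auto
  have Y_meas[measurable]: "compound_sum N X t \<in> borel_measurable M"
    unfolding compound_sum_def[abs_def] by (rule measurable_compose_countable[OF sum_meas N_meas])
  have dens: "compound_poisson_density J x t = (\<Sum>n. w (Suc n) * c n x)" for x
  proof -
    have "summable (\<lambda>n. t ^ Suc n / fact (Suc n) * c n x)"
      by (rule summable_rabs_cancel[OF summable_c[OF S_weights]])
    from suminf_mult[OF this, of "exp (- t)"] show ?thesis
      unfolding density_eq_S S_def w_def by (simp only: mult.assoc)
  qed
  \<comment> \<open>Used with \<open>B = {..y}\<close> for the distribution function and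
    \<open>B = UNIV\<close> for integrability of the density.\<close>
  have series: "integrable lborel (\<lambda>x. \<Sum>n. indicator B x * (w (Suc n) * c n x))"
    "(\<lambda>n. w (Suc n) * (LBINT x:B. c n x)) sums (\<integral>x. (\<Sum>n. indicator B x * (w (Suc n) * c n x)) \<partial>lborel)"
    if B[measurable]: "B \<in> sets borel" for B
  proof -
    have i: "integrable lborel (\<lambda>x. indicator B x * (w (Suc n) * c n x))" for n
      using integrable_mult_indicator[of B lborel "\<lambda>x. w (Suc n) * c n x"] c_int(1) by simp
    have le: "(\<integral>x. norm (indicator B x * (w (Suc n) * c n x)) \<partial>lborel) \<le> w (Suc n)" for n
    proof -
      have "(\<integral>x. norm (indicator B x * (w (Suc n) * c n x)) \<partial>lborel) \<le> (\<integral>x. w (Suc n) * c n x \<partial>lborel)"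
        using i c_int(1) w by (intro integral_mono) (auto simp: abs_mult c_nonneg indicator_def)
      then show ?thesis using c_int(2) by simp
    qed
    have s1: "AE x in lborel. summable (\<lambda>n. norm (indicator B x * (w (Suc n) * c n x)))"
      using summable_c[of "\<lambda>n. w (Suc n)"] sw w
      by (intro AE_I2) (auto simp: abs_mult c_nonneg intro!: summable_mult)
    have s2: "summable (\<lambda>n. \<integral>x. norm (indicator B x * (w (Suc n) * c n x)) \<partial>lborel)"
      by (rule summable_comparison_test'[OF sw, of 0]) (use le in auto)
    show "integrable lborel (\<lambda>x. \<Sum>n. indicator B x * (w (Suc n) * c n x))"
      by (rule integrable_suminf[OF i s1 s2])
    have "(\<integral>x. indicator B x * (w (Suc n) * c n x) \<partial>lborel) = w (Suc n) * (LBINT x:B. c n x)" for n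
      unfolding set_lebesgue_integral_def
      by (subst Bochner_Integration.integral_mult_right_zero[symmetric]) (simp add: mult.left_commute)
    then show "(\<lambda>n. w (Suc n) * (LBINT x:B. c n x)) sums (\<integral>x. (\<Sum>n. indicator B x * (w (Suc n) * c n x)) \<partial>lborel)"
      using sums_integral[OF i s1 s2] by simp
  qed
  have "cdf (distr M borel (compound_sum N X t)) y
      = exp (- t) * indicator {0..} y + (LBINT x:{..y}. compound_poisson_density J x t)" for y
  proof -
    define Ev where "Ev n = {\<omega> \<in> space M. N t \<omega> = n \<and> (\<Sum>j=1..n. X j \<omega>) \<le> y}" for n
    have Ev_meas[measurable]: "Ev n \<in> sets M" for n unfolding Ev_def by measurable
    have pE: "M.prob (Ev n) = w n * M.prob {\<omega> \<in> space M. (\<Sum>j=1..n. X j \<omega>) \<le> y}" for n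
      unfolding Ev_def M.indep_process_sequence_prob[OF NX t] M.poisson_process_prob[OF N t] w_def ..
    have pE0: "M.prob (Ev 0) = exp (- t) * indicator {0..} y"
      by (simp add: pE w_def indicator_def M.prob_space)
    have pES: "M.prob (Ev (Suc n)) = w (Suc n) * (LBINT x:{..y}. c n x)" for n
      by (simp only: pE c_int(3)[of n y])
    have "(\<lambda>n. M.prob (Ev n)) sums M.prob (\<Union>n. Ev n)"
    proof (rule M.finite_measure_UNION)
      show "disjoint_family Ev" by (auto simp: disjoint_family_on_def Ev_def)
    qed (use Ev_meas in auto)
    then have "(\<lambda>n. w (Suc n) * (LBINT x:{..y}. c n x)) sums (M.prob (\<Union>n. Ev n) - exp (- t) * indicator {0..} y)"
      unfolding pES[symmetric] pE0[symmetric] by (subst sums_Suc_iff) simp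
    from sums_unique2[OF this series(2)]
    have "M.prob (\<Union>n. Ev n) = exp (- t) * indicator {0..} y
        + (\<integral>x. (\<Sum>n. indicator {..y} x * (w (Suc n) * c n x)) \<partial>lborel)" by simp
    moreover have "(\<Sum>n. indicator {..y} x * (w (Suc n) * c n x)) = indicator {..y} x *\<^sub>R compound_poisson_density J x t" for x
      by (cases "x \<in> {..y}") (simp_all add: dens)
    moreover have "cdf (distr M borel (compound_sum N X t)) y = M.prob (\<Union>n. Ev n)"
      unfolding cdf_def by (subst measure_distr) (auto simp: Ev_def compound_sum_def intro!: arg_cong[where f = M.prob])
    ultimately show ?thesis by (simp add: set_lebesgue_integral_def)
  qed
  moreover have "integrable lborel (\<lambda>x. compound_poisson_density J x t)"
    using series(1)[of UNIV] by (simp add: dens)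
  moreover have "0 \<le> compound_poisson_density J x t" for x
    using S_nonneg[OF t] by (simp add: density_eq_S)
  ultimately show ?thesis by (simp add: M.ac_component_density_def)
qed

end

theorem theorem9:
  fixes P :: "'p measure" and \<alpha> :: "'p \<Rightarrow> real" and q :: "real \<Rightarrow> real"
    and M :: "'a measure" and N :: "real \<Rightarrow> 'a \<Rightarrow> nat" and X :: "nat \<Rightarrow> 'a \<Rightarrow> real"
  assumes "prob_space P"
    and "distributed P lborel \<alpha> (\<lambda>a. ennreal (q a))"
    and "\<And>a. 0 \<le> q a"
    and "AE \<omega> in P. \<alpha> \<omega> \<in> {0<..<1}"
    and "set_integrable lborel {0<..<1} (\<lambda>a. k_rate a * q a)"
    and "prob_space M"
    and "prob_space.poisson_process M 1 N"
    and "prob_space.indep_vars M (\<lambda>_. borel) X {1..}"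
    and "\<And>j. 1 \<le> j \<Longrightarrow> distributed M lborel (X j) (\<lambda>x. ennreal (jump_density q x))"
    and "prob_space.indep_process_sequence M N X"
  shows "(\<forall>t\<ge>0. prob_space.ac_component_density M (exp (- t)) (compound_sum N X t)
              (\<lambda>x. compound_poisson_density (jump_density q) x t)) \<and>
         CF_solution q (compound_poisson_density (jump_density q)) \<and>
         (\<forall>g. CF_solution q g \<longrightarrow>
              (\<forall>x\<ge>0. \<forall>t\<ge>0. g x t = compound_poisson_density (jump_density q) x t))"
proof -
  interpret P: prob_space P by fact
  \<comment> \<open>The law of \<alpha>, placed on the open interval so that \<open>k_rate\<close>
    is nonnegative on the whole space.\<close>
  define \<mu> where "\<mu> = density (restrict_space lborel {0<..<1}) (\<lambda>a. ennreal (q a))"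
  \<comment> \<open>The hypothesis \<open>distributed\<close> yields measurability only of the
    extended density; nonnegativity recovers \<open>q\<close> from it.\<close>
  have "(\<lambda>a. enn2real (ennreal (q a))) \<in> borel_measurable borel"
    using distributed_borel_measurable[OF assms(2)] by measurable
  then have q_meas[measurable]: "q \<in> borel_measurable borel" using assms(3) by simp
  have q_restr[measurable]: "q \<in> borel_measurable (restrict_space lborel {0<..<1})"
    by (rule measurable_restrict_space1) simp
  have [measurable]: "k_rate \<in> borel_measurable borel" unfolding k_rate_def[abs_def] by measurable
  have sp: "space \<mu> = {0<..<1}" by (simp add: \<mu>_def space_restrict_space)
  have int: "(\<integral>a. g a \<partial>\<mu>) = (LBINT a:{0<..<1}. g a * q a)"
    and integrable: "integrable \<mu> g \<longleftrightarrow> set_integrable lborel {0<..<1} (\<lambda>a. g a * q a)"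
    if g[measurable]: "g \<in> borel_measurable borel" for g :: "real \<Rightarrow> real"
  proof -
    have gm: "g \<in> borel_measurable (restrict_space lborel {0<..<1})"
      by (rule measurable_restrict_space1) simp
    show "(\<integral>a. g a \<partial>\<mu>) = (LBINT a:{0<..<1}. g a * q a)"
      unfolding \<mu>_def using assms(3)
      by (simp add: integral_density[OF gm q_restr] integral_restrict_space set_lebesgue_integral_def mult.commute)
    show "integrable \<mu> g \<longleftrightarrow> set_integrable lborel {0<..<1} (\<lambda>a. g a * q a)"
      unfolding \<mu>_def using assms(3)
      by (simp add: integrable_density[OF gm q_restr] integrable_restrict_space set_integrable_def mult.commute)
  qed
  have "prob_space \<mu>"
  proof
    have "emeasure \<mu> (space \<mu>) = (\<integral>\<^sup>+a. ennreal (q a) \<partial>restrict_space lborel {0<..<1})"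
      unfolding sp unfolding \<mu>_def
      by (subst emeasure_density) (auto simp: sets_restrict_space_iff space_restrict_space intro!: nn_integral_cong)
    also have "\<dots> = (\<integral>\<^sup>+a. ennreal (q a) * indicator {0<..<1} a \<partial>lborel)"
      by (subst nn_integral_restrict_space) auto
    also have "\<dots> = emeasure P (\<alpha> -` {0<..<1} \<inter> space P)"
      by (rule distributed_emeasure[OF assms(2), symmetric]) simp
    \<comment> \<open>The mass is 1 because \<alpha> lies in the interval almost surely.\<close>
    also have "\<dots> = 1"
      using distributed_measurable[OF assms(2)] assms(4)
      by (subst P.emeasure_eq_1_AE) (auto elim: AE_mp)
    finally show "emeasure \<mu> (space \<mu>) = 1" .
  qed
  then interpret rate_mixture \<mu> k_rate
    by (intro rate_mixture.intro rate_mixture_axioms.intro)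
       (use assms(5) in \<open>auto simp: sp k_rate_def[abs_def] integrable\<close>)
  interpret cf_mixture \<mu> k_rate q
  proof
    show "CF_kernel q = phi"
      by (rule ext) (simp add: CF_kernel_def phi_def int)
    show "A_q q = A"
      by (rule ext) (simp add: A_q_def A_def int)
    show "B_q q = (\<lambda>x. K * phi x)"
      by (rule ext) (simp add: B_q_def K_def phi_def int)
  qed
  have J: "jump_density q = J" by (simp add: fun_eq_iff jump_density_def J_def A_q)
  show ?thesis
    using ac_component_density_compound_sum[OF assms(6-8) _ assms(10)] assms(9)
      CF_solution_f CF_solution_unique
    unfolding f_def J by blast
qed

end
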